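(* Let $A$, $B$, $C$ be algebras and let $R_1:B\otimes A\to A\otimes B$, $R_2:C\otimes B\to B\otimes C$, $R_3:C\otimes A\to A\otimes C$ be unital twisting maps. Define $$T_1:C\otimes (A\otimes_{R_1}B)\to (A\otimes_{R_1}B)\otimes C,\qquad T_1:=(A\otimes R_2)\circ(R_3\otimes B),$$ $$T_2:(B\otimes_{R_2}C)\otimes A\to A\otimes(B\otimes_{R_2}C),\qquad T_2:=(R_1\otimes C)\circ(B\otimes R_3).$$ The following conditions are equivalent: (1) $T_1$ is a twisting map. (2) $T_2$ is a twisting map. (3) $R_1,R_2,R_3$ satisfy the hexagon equation $$(A\otimes R_2)\circ(R_3\otimes B)\circ(C\otimes R_1)=(R_1\otimes C)\circ(B\otimes R_3)\circ(R_2\otimes A)$$ as maps $C\otimes B\otimes A\to A\otimes B\otimes C$. Moreover, if these conditions are satisfied, then the algebras $A\otimes_{T_2}(B\otimes_{R_2}C)$ and $(A\otimes_{R_1}B)\otimes_{T_1}C$ are equal (i.e. they have the same multiplication on $A\otimes B\otimes C$).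
   Context: Fix a field or commutative ring $k$; $\otimes=\otimes_k$; algebras are associative unital $k$-algebras and $\mu_A$ denotes the product of $A$. An object also denotes its identity map, so $A\otimes f=\mathrm{id}_A\otimes f$. A twisting map for algebras $A,B$ is a $k$-linear map $R:B\otimes A\to A\otimes B$ with $$R\circ(B\otimes\mu_A)=(\mu_A\otimes B)\circ(A\otimes R)\circ(R\otimes A),\qquad R\circ(\mu_B\otimes A)=(A\otimes\mu_B)\circ(R\otimes B)\circ(B\otimes R).$$ Then $A\otimes_R B$ denotes $A\otimes B$ with the associative product $\mu_R:=(\mu_A\otimes\mu_B)\circ(A\otimes R\otimes B)$. $R$ is unital if $R(1\otimes a)=a\otimes 1$ and $R(b\otimes 1)=1\otimes b$ for all $a\in A$, $b\in B$; in that case $A\otimes_R B$ has unit $1\otimes1$. *)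

theory Defs
  imports "HOL-Algebra.Module" "HOL-Algebra.QuotRing"
begin

section \<open>Modules and algebras over a commutative ring\<close>

text \<open>The library locale \<^locale>\<open>algebra\<close> demands a commutative product, hence the
  following one, for associative unital algebras.\<close>

locale assoc_algebra = module K A + A?: ring A for K (structure) and A (structure) +
  assumes smult_mult_left:
    "\<lbrakk>r \<in> carrier K; x \<in> carrier A; y \<in> carrier A\<rbrakk>
      \<Longrightarrow> (r \<odot>\<^bsub>A\<^esub> x) \<otimes>\<^bsub>A\<^esub> y = r \<odot>\<^bsub>A\<^esub> (x \<otimes>\<^bsub>A\<^esub> y)"
  and smult_mult_right:
    "\<lbrakk>r \<in> carrier K; x \<in> carrier A; y \<in> carrier A\<rbrakk>
      \<Longrightarrow> x \<otimes>\<^bsub>A\<^esub> (r \<odot>\<^bsub>A\<^esub> y) = r \<odot>\<^bsub>A\<^esub> (x \<otimes>\<^bsub>A\<^esub> y)"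

definition module_hom ::
  "('k, 'r) ring_scheme \<Rightarrow> ('k, 'a) module \<Rightarrow> ('k, 'b) module \<Rightarrow> ('a \<Rightarrow> 'b) set" where
  "module_hom K M N =
    {f. f \<in> carrier M \<rightarrow> carrier N \<and>
        (\<forall>x\<in>carrier M. \<forall>y\<in>carrier M. f (x \<oplus>\<^bsub>M\<^esub> y) = f x \<oplus>\<^bsub>N\<^esub> f y) \<and>
        (\<forall>r\<in>carrier K. \<forall>x\<in>carrier M. f (r \<odot>\<^bsub>M\<^esub> x) = r \<odot>\<^bsub>N\<^esub> f x)}"

definition algebra_iso ::
  "('k, 'r) ring_scheme \<Rightarrow> ('k, 'a) module \<Rightarrow> ('k, 'b) module \<Rightarrow> ('a \<Rightarrow> 'b) set" where
  "algebra_iso K A B = ring_iso A B \<inter> module_hom K A B"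


section \<open>Tensor products of modules\<close>

text \<open>The tensor product is the free module on \<open>carrier M \<times> carrier N\<close> modulo the bilinearity
  relations.  A module is a record that also has fields for a product and a unit; they play no
  role for mere modules and are left undefined there.\<close>

definition free_module :: "('k, 'r) ring_scheme \<Rightarrow> 'x set \<Rightarrow> ('k, 'x \<Rightarrow> 'k) module" where
  "free_module K X =
    \<lparr>carrier = {f. (\<forall>x. f x \<in> carrier K) \<and> finite {x. f x \<noteq> \<zero>\<^bsub>K\<^esub>} \<and> {x. f x \<noteq> \<zero>\<^bsub>K\<^esub>} \<subseteq> X},
     mult = undefined, one = undefined,
     zero = (\<lambda>x. \<zero>\<^bsub>K\<^esub>), add = (\<lambda>f g x. f x \<oplus>\<^bsub>K\<^esub> g x),
     smult = (\<lambda>r f x. r \<otimes>\<^bsub>K\<^esub> f x)\<rparr>"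

definition free_gen :: "('k, 'r) ring_scheme \<Rightarrow> 'x \<Rightarrow> 'x \<Rightarrow> 'k" where
  "free_gen K x = (\<lambda>y. if y = x then \<one>\<^bsub>K\<^esub> else \<zero>\<^bsub>K\<^esub>)"

definition submodule_span ::
  "('k, 'r) ring_scheme \<Rightarrow> ('k, 'a) module \<Rightarrow> 'a set \<Rightarrow> 'a set" where
  "submodule_span K M S = \<Inter>{H. submodule H K M \<and> S \<subseteq> H}"

definition quotient_module ::
  "('k, 'r) ring_scheme \<Rightarrow> ('k, 'a) module \<Rightarrow> 'a set \<Rightarrow> ('k, 'a set) module" where
  "quotient_module K M H =
    \<lparr>carrier = a_rcosets\<^bsub>M\<^esub> H, mult = undefined, one = undefined,
     zero = H, add = set_add M,
     smult = (\<lambda>r X. \<Union>x\<in>X. H +>\<^bsub>M\<^esub> (r \<odot>\<^bsub>M\<^esub> x))\<rparr>"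

definition bilinear_relations ::
  "('k, 'r) ring_scheme \<Rightarrow> ('k, 'a) module \<Rightarrow> ('k, 'b) module \<Rightarrow> ('a \<times> 'b \<Rightarrow> 'k) set" where
  "bilinear_relations K M N =
    (let F = free_module K (carrier M \<times> carrier N); e = free_gen K in
      {e (m \<oplus>\<^bsub>M\<^esub> m', n) \<ominus>\<^bsub>F\<^esub> (e (m, n) \<oplus>\<^bsub>F\<^esub> e (m', n)) | m m' n.
          m \<in> carrier M \<and> m' \<in> carrier M \<and> n \<in> carrier N} \<union>
      {e (m, n \<oplus>\<^bsub>N\<^esub> n') \<ominus>\<^bsub>F\<^esub> (e (m, n) \<oplus>\<^bsub>F\<^esub> e (m, n')) | m n n'.
          m \<in> carrier M \<and> n \<in> carrier N \<and> n' \<in> carrier N} \<union>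
      {e (r \<odot>\<^bsub>M\<^esub> m, n) \<ominus>\<^bsub>F\<^esub> (r \<odot>\<^bsub>F\<^esub> e (m, n)) | r m n.
          r \<in> carrier K \<and> m \<in> carrier M \<and> n \<in> carrier N} \<union>
      {e (m, r \<odot>\<^bsub>N\<^esub> n) \<ominus>\<^bsub>F\<^esub> (r \<odot>\<^bsub>F\<^esub> e (m, n)) | r m n.
          r \<in> carrier K \<and> m \<in> carrier M \<and> n \<in> carrier N})"

type_synonym ('k, 'a, 'b) tensor = "('a \<times> 'b \<Rightarrow> 'k) set"

definition tensor_relations ::
  "('k, 'r) ring_scheme \<Rightarrow> ('k, 'a) module \<Rightarrow> ('k, 'b) module \<Rightarrow> ('a \<times> 'b \<Rightarrow> 'k) set" where
  "tensor_relations K M N =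
    submodule_span K (free_module K (carrier M \<times> carrier N)) (bilinear_relations K M N)"

definition tensor ::
  "('k, 'r) ring_scheme \<Rightarrow> ('k, 'a) module \<Rightarrow> ('k, 'b) module \<Rightarrow> ('k, ('k, 'a, 'b) tensor) module"
  where
  "tensor K M N =
    quotient_module K (free_module K (carrier M \<times> carrier N)) (tensor_relations K M N)"

definition pure_tensor ::
  "('k, 'r) ring_scheme \<Rightarrow> ('k, 'a) module \<Rightarrow> ('k, 'b) module \<Rightarrow> 'a \<Rightarrow> 'b \<Rightarrow> ('k, 'a, 'b) tensor"
  where
  "pure_tensor K M N m n =
    tensor_relations K M N +>\<^bsub>free_module K (carrier M \<times> carrier N)\<^esub> free_gen K (m, n)"

text \<open>The linear map out of \<open>M \<otimes> N\<close> induced by a bilinear map \<open>\<phi>\<close> with values in \<open>P\<close>: the linear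
  extension of \<open>\<phi>\<close> is evaluated at a representative of the coset \<open>X\<close>.  For bilinear \<open>\<phi>\<close> the
  choice does not matter.\<close>

definition tensor_lift ::
  "('k, 'r) ring_scheme \<Rightarrow> ('k, 'c) module \<Rightarrow> ('a \<Rightarrow> 'b \<Rightarrow> 'c) \<Rightarrow> ('k, 'a, 'b) tensor \<Rightarrow> 'c" where
  "tensor_lift K P \<phi> X =
    (let f = (SOME f. f \<in> X)
     in \<Oplus>\<^bsub>P\<^esub>p\<in>{p. f p \<noteq> \<zero>\<^bsub>K\<^esub>}. f p \<odot>\<^bsub>P\<^esub> \<phi> (fst p) (snd p))"

text \<open>\<open>f \<otimes> g\<close>, where \<open>M'\<close> and \<open>N'\<close> are the codomains of \<open>f\<close> and \<open>g\<close>.\<close>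

definition tensor_map ::
  "('k, 'r) ring_scheme \<Rightarrow> ('k, 'c) module \<Rightarrow> ('k, 'd) module \<Rightarrow> ('a \<Rightarrow> 'c) \<Rightarrow> ('b \<Rightarrow> 'd) \<Rightarrow>
    ('k, 'a, 'b) tensor \<Rightarrow> ('k, 'c, 'd) tensor" where
  "tensor_map K M' N' f g =
    tensor_lift K (tensor K M' N') (\<lambda>m n. pure_tensor K M' N' (f m) (g n))"

text \<open>The canonical isomorphism \<open>(M \<otimes> N) \<otimes> P \<rightarrow> M \<otimes> (N \<otimes> P)\<close> and its inverse, which on paper
  are treated as identities.\<close>

definition tensor_assoc ::
  "('k, 'r) ring_scheme \<Rightarrow> ('k, 'a) module \<Rightarrow> ('k, 'b) module \<Rightarrow> ('k, 'c) module \<Rightarrow>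
    ('k, ('k, 'a, 'b) tensor, 'c) tensor \<Rightarrow> ('k, 'a, ('k, 'b, 'c) tensor) tensor" where
  "tensor_assoc K M N P =
    (let T = tensor K M (tensor K N P) in
     tensor_lift K T (\<lambda>u p.
       tensor_lift K T (\<lambda>m n. pure_tensor K M (tensor K N P) m (pure_tensor K N P n p)) u))"

definition tensor_assoc_inv ::
  "('k, 'r) ring_scheme \<Rightarrow> ('k, 'a) module \<Rightarrow> ('k, 'b) module \<Rightarrow> ('k, 'c) module \<Rightarrow>
    ('k, 'a, ('k, 'b, 'c) tensor) tensor \<Rightarrow> ('k, ('k, 'a, 'b) tensor, 'c) tensor" where
  "tensor_assoc_inv K M N P =
    (let T = tensor K (tensor K M N) P in
     tensor_lift K T (\<lambda>m v.
       tensor_lift K T (\<lambda>n p. pure_tensor K (tensor K M N) P (pure_tensor K M N m n) p) v))"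


section \<open>Twisting maps and twisted tensor products\<close>

definition mult_map ::
  "('k, 'r) ring_scheme \<Rightarrow> ('k, 'a) module \<Rightarrow> ('k, 'a, 'a) tensor \<Rightarrow> 'a" where
  "mult_map K A = tensor_lift K A (\<lambda>x y. x \<otimes>\<^bsub>A\<^esub> y)"

text \<open>The two equations are read on \<open>B \<otimes> (A \<otimes> A)\<close> and on \<open>(B \<otimes> B) \<otimes> A\<close>, respectively.\<close>

definition twisting_map ::
  "('k, 'r) ring_scheme \<Rightarrow> ('k, 'a) module \<Rightarrow> ('k, 'b) module \<Rightarrow>
    (('k, 'b, 'a) tensor \<Rightarrow> ('k, 'a, 'b) tensor) \<Rightarrow> bool" where
  "twisting_map K A B R \<longleftrightarrow>
    R \<in> module_hom K (tensor K B A) (tensor K A B) \<and>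
    (\<forall>x\<in>carrier (tensor K B (tensor K A A)).
      (R \<circ> tensor_map K B A id (mult_map K A)) x =
      (tensor_map K A B (mult_map K A) id \<circ> tensor_assoc_inv K A A B \<circ>
       tensor_map K A (tensor K A B) id R \<circ> tensor_assoc K A B A \<circ>
       tensor_map K (tensor K A B) A R id \<circ> tensor_assoc_inv K B A A) x) \<and>
    (\<forall>x\<in>carrier (tensor K (tensor K B B) A).
      (R \<circ> tensor_map K B A (mult_map K B) id) x =
      (tensor_map K A B id (mult_map K B) \<circ> tensor_assoc K A B B \<circ>
       tensor_map K (tensor K A B) B R id \<circ> tensor_assoc_inv K B A B \<circ>
       tensor_map K B (tensor K A B) id R \<circ> tensor_assoc K B B A) x)"

definition unital_twisting_map ::
  "('k, 'r) ring_scheme \<Rightarrow> ('k, 'a) module \<Rightarrow> ('k, 'b) module \<Rightarrow>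
    (('k, 'b, 'a) tensor \<Rightarrow> ('k, 'a, 'b) tensor) \<Rightarrow> bool" where
  "unital_twisting_map K A B R \<longleftrightarrow>
    twisting_map K A B R \<and>
    (\<forall>a\<in>carrier A. R (pure_tensor K B A \<one>\<^bsub>B\<^esub> a) = pure_tensor K A B a \<one>\<^bsub>B\<^esub>) \<and>
    (\<forall>b\<in>carrier B. R (pure_tensor K B A b \<one>\<^bsub>A\<^esub>) = pure_tensor K A B \<one>\<^bsub>A\<^esub> b)"

text \<open>\<open>\<mu>\<^sub>R = (\<mu>\<^sub>A \<otimes> \<mu>\<^sub>B) \<circ> (A \<otimes> R \<otimes> B)\<close> on \<open>(A \<otimes> B) \<otimes> (A \<otimes> B)\<close>; the middle map is
  \<open>A \<otimes> (R \<otimes> B)\<close>.\<close>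

definition twisted_mult_map ::
  "('k, 'r) ring_scheme \<Rightarrow> ('k, 'a) module \<Rightarrow> ('k, 'b) module \<Rightarrow>
    (('k, 'b, 'a) tensor \<Rightarrow> ('k, 'a, 'b) tensor) \<Rightarrow>
    ('k, ('k, 'a, 'b) tensor, ('k, 'a, 'b) tensor) tensor \<Rightarrow> ('k, 'a, 'b) tensor" where
  "twisted_mult_map K A B R =
    tensor_map K A B (mult_map K A) (mult_map K B) \<circ>
    tensor_assoc_inv K A A (tensor K B B) \<circ>
    tensor_map K A (tensor K A (tensor K B B)) id (tensor_assoc K A B B) \<circ>
    tensor_map K A (tensor K (tensor K A B) B) id (tensor_map K (tensor K A B) B R id) \<circ>
    tensor_map K A (tensor K (tensor K B A) B) id (tensor_assoc_inv K B A B) \<circ>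
    tensor_assoc K A B (tensor K A B)"

definition twisted_tensor ::
  "('k, 'r) ring_scheme \<Rightarrow> ('k, 'a) module \<Rightarrow> ('k, 'b) module \<Rightarrow>
    (('k, 'b, 'a) tensor \<Rightarrow> ('k, 'a, 'b) tensor) \<Rightarrow> ('k, ('k, 'a, 'b) tensor) module" where
  "twisted_tensor K A B R =
    (tensor K A B)
      \<lparr>mult := \<lambda>x y. twisted_mult_map K A B R (pure_tensor K (tensor K A B) (tensor K A B) x y),
       one := pure_tensor K A B \<one>\<^bsub>A\<^esub> \<one>\<^bsub>B\<^esub>\<rparr>"

text \<open>\<open>(A \<otimes> R\<^sub>2) \<circ> (R\<^sub>3 \<otimes> B) : C \<otimes> (A \<otimes> B) \<rightarrow> (A \<otimes> B) \<otimes> C\<close>\<close>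

definition twist_T1 ::
  "('k, 'r) ring_scheme \<Rightarrow> ('k, 'a) module \<Rightarrow> ('k, 'b) module \<Rightarrow> ('k, 'c) module \<Rightarrow>
    (('k, 'c, 'b) tensor \<Rightarrow> ('k, 'b, 'c) tensor) \<Rightarrow>
    (('k, 'c, 'a) tensor \<Rightarrow> ('k, 'a, 'c) tensor) \<Rightarrow>
    ('k, 'c, ('k, 'a, 'b) tensor) tensor \<Rightarrow> ('k, ('k, 'a, 'b) tensor, 'c) tensor" where
  "twist_T1 K A B C R2 R3 =
    tensor_assoc_inv K A B C \<circ> tensor_map K A (tensor K B C) id R2 \<circ> tensor_assoc K A C B \<circ>
    tensor_map K (tensor K A C) B R3 id \<circ> tensor_assoc_inv K C A B"

text \<open>\<open>(R\<^sub>1 \<otimes> C) \<circ> (B \<otimes> R\<^sub>3) : (B \<otimes> C) \<otimes> A \<rightarrow> A \<otimes> (B \<otimes> C)\<close>\<close>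

definition twist_T2 ::
  "('k, 'r) ring_scheme \<Rightarrow> ('k, 'a) module \<Rightarrow> ('k, 'b) module \<Rightarrow> ('k, 'c) module \<Rightarrow>
    (('k, 'b, 'a) tensor \<Rightarrow> ('k, 'a, 'b) tensor) \<Rightarrow>
    (('k, 'c, 'a) tensor \<Rightarrow> ('k, 'a, 'c) tensor) \<Rightarrow>
    ('k, ('k, 'b, 'c) tensor, 'a) tensor \<Rightarrow> ('k, 'a, ('k, 'b, 'c) tensor) tensor" where
  "twist_T2 K A B C R1 R3 =
    tensor_assoc K A B C \<circ> tensor_map K (tensor K A B) C R1 id \<circ> tensor_assoc_inv K B A C \<circ>
    tensor_map K B (tensor K A C) id R3 \<circ> tensor_assoc K B C A"

text \<open>Both sides are read as maps \<open>(C \<otimes> B) \<otimes> A \<rightarrow> A \<otimes> (B \<otimes> C)\<close>.\<close>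

definition hexagon_equation ::
  "('k, 'r) ring_scheme \<Rightarrow> ('k, 'a) module \<Rightarrow> ('k, 'b) module \<Rightarrow> ('k, 'c) module \<Rightarrow>
    (('k, 'b, 'a) tensor \<Rightarrow> ('k, 'a, 'b) tensor) \<Rightarrow>
    (('k, 'c, 'b) tensor \<Rightarrow> ('k, 'b, 'c) tensor) \<Rightarrow>
    (('k, 'c, 'a) tensor \<Rightarrow> ('k, 'a, 'c) tensor) \<Rightarrow> bool" where
  "hexagon_equation K A B C R1 R2 R3 \<longleftrightarrow>
    (\<forall>x\<in>carrier (tensor K (tensor K C B) A).
      (tensor_map K A (tensor K B C) id R2 \<circ> tensor_assoc K A C B \<circ>
       tensor_map K (tensor K A C) B R3 id \<circ> tensor_assoc_inv K C A B \<circ>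
       tensor_map K C (tensor K A B) id R1 \<circ> tensor_assoc K C B A) x =
      (tensor_assoc K A B C \<circ> tensor_map K (tensor K A B) C R1 id \<circ> tensor_assoc_inv K B A C \<circ>
       tensor_map K B (tensor K A C) id R3 \<circ> tensor_assoc K B C A \<circ>
       tensor_map K (tensor K B C) A R2 id) x)"

end

theory Submission
  imports Defs
begin

text \<open>A linear map out of a tensor product is determined by its values on pure tensors, and these
  are computed in Sweedler style.  Of the two twisting identities of \<open>T\<^sub>1\<close>, the one for the product
  of \<open>C\<close> follows from the identities of \<open>R\<^sub>2\<close> and \<open>R\<^sub>3\<close> alone.  In the one for the product of
  \<open>A \<otimes> B\<close>, evaluated at \<open>c \<otimes> (a \<otimes> b) \<otimes> (a' \<otimes> b')\<close>, both sides are the same sum except that one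
  contains the left and the other the right side of the hexagon, applied to \<open>b\<close>, \<open>a'\<close> and a factor
  coming from \<open>R\<^sub>3(c \<otimes> a)\<close>.  So the hexagon implies the identity, and \<open>a = 1\<close>, \<open>b' = 1\<close> gives the
  hexagon back, because the twisting maps are unital.  The argument for \<open>T\<^sub>2\<close> is the mirror image.
  The products of two pure tensors in the two algebras on \<open>A \<otimes> B \<otimes> C\<close> differ only in the order
  in which \<open>R\<^sub>1\<close> and \<open>R\<^sub>2\<close> are applied to disjoint factors.\<close>

section \<open>Linear maps, free modules and quotient modules\<close>

lemma module_homI:
  assumes "\<And>x. x \<in> carrier M \<Longrightarrow> f x \<in> carrier N"
    and "\<And>x y. \<lbrakk>x \<in> carrier M; y \<in> carrier M\<rbrakk> \<Longrightarrow> f (x \<oplus>\<^bsub>M\<^esub> y) = f x \<oplus>\<^bsub>N\<^esub> f y"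
    and "\<And>r x. \<lbrakk>r \<in> carrier K; x \<in> carrier M\<rbrakk> \<Longrightarrow> f (r \<odot>\<^bsub>M\<^esub> x) = r \<odot>\<^bsub>N\<^esub> f x"
  shows "f \<in> module_hom K M N"
  using assms by (auto simp: module_hom_def)

lemma module_homD:
  assumes "f \<in> module_hom K M N"
  shows "x \<in> carrier M \<Longrightarrow> f x \<in> carrier N"
    and "\<lbrakk>x \<in> carrier M; y \<in> carrier M\<rbrakk> \<Longrightarrow> f (x \<oplus>\<^bsub>M\<^esub> y) = f x \<oplus>\<^bsub>N\<^esub> f y"
    and "\<lbrakk>r \<in> carrier K; x \<in> carrier M\<rbrakk> \<Longrightarrow> f (r \<odot>\<^bsub>M\<^esub> x) = r \<odot>\<^bsub>N\<^esub> f x"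
  using assms by (auto simp: module_hom_def)

lemma module_hom_cong:
  assumes "\<And>x. x \<in> carrier M \<Longrightarrow> f x = g x" "module K M"
  shows "f \<in> module_hom K M N \<longleftrightarrow> g \<in> module_hom K M N"
proof -
  interpret M: module K M by fact
  show ?thesis using assms(1) by (auto simp: module_hom_def Pi_def)
qed

lemma module_hom_id: "(\<lambda>x. x) \<in> module_hom K M M"
  by (auto simp: module_hom_def)

lemma module_hom_comp:
  "\<lbrakk>g \<in> module_hom K N P; f \<in> module_hom K M N\<rbrakk> \<Longrightarrow> (\<lambda>x. g (f x)) \<in> module_hom K M P"
  by (auto simp: module_hom_def Pi_def)

lemma module_hom_zero:
  assumes "module K M" "module K N" "f \<in> module_hom K M N"
  shows "f \<zero>\<^bsub>M\<^esub> = \<zero>\<^bsub>N\<^esub>"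
proof -
  interpret M: module K M by fact
  interpret N: module K N by fact
  have "f (\<zero>\<^bsub>K\<^esub> \<odot>\<^bsub>M\<^esub> \<zero>\<^bsub>M\<^esub>) = \<zero>\<^bsub>K\<^esub> \<odot>\<^bsub>N\<^esub> f \<zero>\<^bsub>M\<^esub>"
    by (intro module_homD(3)[OF assms(3)]) auto
  then show ?thesis using module_homD(1)[OF assms(3)] by simp
qed

lemma module_hom_finsum:
  assumes "module K M" "module K N" "f \<in> module_hom K M N"
    and "\<And>i. i \<in> S \<Longrightarrow> h i \<in> carrier M"
  shows "f (\<Oplus>\<^bsub>M\<^esub>i\<in>S. h i) = (\<Oplus>\<^bsub>N\<^esub>i\<in>S. f (h i))"
  using assms(4)
proof (induction S rule: infinite_finite_induct)
  case (insert i S)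
  interpret M: module K M by fact
  interpret N: module K N by fact
  have "h \<in> S \<rightarrow> carrier M" "h i \<in> carrier M" using insert.prems by auto
  moreover from this have "(\<lambda>j. f (h j)) \<in> S \<rightarrow> carrier N" "f (h i) \<in> carrier N"
    using module_homD(1)[OF assms(3)] by auto
  ultimately show ?case
    using insert by (simp add: M.finsum_insert N.finsum_insert module_homD(2)[OF assms(3)])
qed (simp_all add: abelian_monoid.finsum_infinite abelian_monoid.finsum_empty module_hom_zero[OF assms(1-3)]
       abelian_group.axioms(1) module.axioms(2)[OF assms(1)] module.axioms(2)[OF assms(2)])

lemma module_hom_kernel:
  assumes "module K M" "module K N" "f \<in> module_hom K M N"
  shows "submodule {x \<in> carrier M. f x = \<zero>\<^bsub>N\<^esub>} K M"
proof -
  interpret M: module K M by fact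
  interpret N: module K N by fact
  have m: "\<ominus>\<^bsub>M\<^esub> x = (\<ominus>\<^bsub>K\<^esub> \<one>\<^bsub>K\<^esub>) \<odot>\<^bsub>M\<^esub> x" if "x \<in> carrier M" for x
    using that by (simp add: M.smult_l_minus)
  show ?thesis
  proof (rule M.submoduleI)
    fix a assume "a \<in> {x \<in> carrier M. f x = \<zero>\<^bsub>N\<^esub>}"
    then show "\<ominus>\<^bsub>M\<^esub> a \<in> {x \<in> carrier M. f x = \<zero>\<^bsub>N\<^esub>}"
      using module_homD(3)[OF assms(3), of "\<ominus>\<^bsub>K\<^esub> \<one>\<^bsub>K\<^esub>" a] by (auto simp: m[symmetric])
  qed (auto simp: module_homD[OF assms(3)] module_hom_zero[OF assms])
qed

lemma finsum_swap:
  assumes "abelian_monoid G" "finite S" "finite T"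
    and "\<And>i j. i \<in> S \<Longrightarrow> j \<in> T \<Longrightarrow> f i j \<in> carrier G"
  shows "(\<Oplus>\<^bsub>G\<^esub>i\<in>S. \<Oplus>\<^bsub>G\<^esub>j\<in>T. f i j) = (\<Oplus>\<^bsub>G\<^esub>j\<in>T. \<Oplus>\<^bsub>G\<^esub>i\<in>S. f i j)"
  using assms(2,4)
proof (induction S rule: finite_induct)
  case empty
  interpret G: abelian_monoid G by fact
  show ?case by (simp add: G.finsum_empty G.finsum_zero)
next
  case (insert i S)
  interpret G: abelian_monoid G by fact
  have "(\<Oplus>\<^bsub>G\<^esub>j\<in>T. \<Oplus>\<^bsub>G\<^esub>i\<in>insert i S. f i j) = (\<Oplus>\<^bsub>G\<^esub>j\<in>T. f i j \<oplus>\<^bsub>G\<^esub> (\<Oplus>\<^bsub>G\<^esub>i\<in>S. f i j))"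
    using insert by (intro G.finsum_cong') (auto intro!: G.finsum_insert G.finsum_closed G.a_closed)
  also have "\<dots> = (\<Oplus>\<^bsub>G\<^esub>j\<in>T. f i j) \<oplus>\<^bsub>G\<^esub> (\<Oplus>\<^bsub>G\<^esub>j\<in>T. \<Oplus>\<^bsub>G\<^esub>i\<in>S. f i j)"
    using insert by (intro G.finsum_addf) (auto intro!: G.finsum_closed)
  also have "(\<Oplus>\<^bsub>G\<^esub>j\<in>T. \<Oplus>\<^bsub>G\<^esub>i\<in>S. f i j) = (\<Oplus>\<^bsub>G\<^esub>i\<in>S. \<Oplus>\<^bsub>G\<^esub>j\<in>T. f i j)"
    using insert by (intro insert.IH[symmetric]) auto
  also have "(\<Oplus>\<^bsub>G\<^esub>j\<in>T. f i j) \<oplus>\<^bsub>G\<^esub> (\<Oplus>\<^bsub>G\<^esub>i\<in>S. \<Oplus>\<^bsub>G\<^esub>j\<in>T. f i j) = (\<Oplus>\<^bsub>G\<^esub>i\<in>insert i S. \<Oplus>\<^bsub>G\<^esub>j\<in>T. f i j)"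
    using insert by (intro G.finsum_insert[symmetric]) (auto intro!: G.finsum_closed)
  finally show ?case by simp
qed

lemma free_module_simps [simp]:
  "zero (free_module K X) = (\<lambda>x. \<zero>\<^bsub>K\<^esub>)"
  "add (free_module K X) f g = (\<lambda>x. f x \<oplus>\<^bsub>K\<^esub> g x)"
  "smult (free_module K X) r f = (\<lambda>x. r \<otimes>\<^bsub>K\<^esub> f x)"
  by (simp_all add: free_module_def)

lemma free_module_carrier:
  "f \<in> carrier (free_module K X) \<longleftrightarrow>
    (\<forall>x. f x \<in> carrier K) \<and> finite {x. f x \<noteq> \<zero>\<^bsub>K\<^esub>} \<and> {x. f x \<noteq> \<zero>\<^bsub>K\<^esub>} \<subseteq> X"
  by (simp add: free_module_def)

lemma free_module_is_module:
  assumes "cring K"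
  shows "module K (free_module K X)"
proof -
  interpret K: cring K by fact
  have supp: "finite {x. h x \<noteq> \<zero>\<^bsub>K\<^esub>} \<and> {x. h x \<noteq> \<zero>\<^bsub>K\<^esub>} \<subseteq> X"
    if "f \<in> carrier (free_module K X)" "g \<in> carrier (free_module K X)"
       "\<And>x. f x = \<zero>\<^bsub>K\<^esub> \<Longrightarrow> g x = \<zero>\<^bsub>K\<^esub> \<Longrightarrow> h x = \<zero>\<^bsub>K\<^esub>" for f g h
  proof -
    have "{x. h x \<noteq> \<zero>\<^bsub>K\<^esub>} \<subseteq> {x. f x \<noteq> \<zero>\<^bsub>K\<^esub>} \<union> {x. g x \<noteq> \<zero>\<^bsub>K\<^esub>}" using that(3) by blast
    then show ?thesis using that(1,2) unfolding free_module_carrier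
      by (meson Un_least finite_UnI finite_subset order_trans)
  qed
  have add: "(\<lambda>x. f x \<oplus>\<^bsub>K\<^esub> g x) \<in> carrier (free_module K X)"
    if "f \<in> carrier (free_module K X)" "g \<in> carrier (free_module K X)" for f g
    using that supp[OF that, of "\<lambda>x. f x \<oplus>\<^bsub>K\<^esub> g x"] by (auto simp: free_module_carrier)
  have smult: "(\<lambda>x. r \<otimes>\<^bsub>K\<^esub> f x) \<in> carrier (free_module K X)"
    if "r \<in> carrier K" "f \<in> carrier (free_module K X)" for r f
    using that supp[OF that(2,2), of "\<lambda>x. r \<otimes>\<^bsub>K\<^esub> f x"] by (auto simp: free_module_carrier)
  show ?thesis
  proof (rule moduleI)
    show "abelian_group (free_module K X)"
    proof (rule abelian_groupI)
      fix f assume f: "f \<in> carrier (free_module K X)"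
      show "\<exists>g\<in>carrier (free_module K X). g \<oplus>\<^bsub>free_module K X\<^esub> f = \<zero>\<^bsub>free_module K X\<^esub>"
        using f supp[OF f f, of "\<lambda>x. \<ominus>\<^bsub>K\<^esub> f x"]
        by (intro bexI[of _ "\<lambda>x. \<ominus>\<^bsub>K\<^esub> f x"]) (auto simp: free_module_carrier K.l_neg fun_eq_iff)
    qed (simp add: add, auto simp: free_module_carrier K.a_ac)
  qed (simp_all add: assms smult, auto simp: free_module_carrier K.l_distr K.r_distr K.m_assoc)
qed

lemma free_gen_closed:
  assumes "cring K" "x \<in> X"
  shows "free_gen K x \<in> carrier (free_module K X)"
proof -
  interpret K: cring K by fact
  have "{y. free_gen K x y \<noteq> \<zero>\<^bsub>K\<^esub>} \<subseteq> {x}" by (auto simp: free_gen_def)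
  then show ?thesis using assms(2) finite_subset[of _ "{x}"]
    by (auto simp: free_module_carrier free_gen_def)
qed

lemma finsum_free_module_apply:
  assumes "cring K" "\<And>i. i \<in> S \<Longrightarrow> h i \<in> carrier (free_module K X)"
  shows "(\<Oplus>\<^bsub>free_module K X\<^esub>i\<in>S. h i) x = (\<Oplus>\<^bsub>K\<^esub>i\<in>S. h i x)"
proof -
  interpret K: cring K by fact
  interpret F: module K "free_module K X" by (rule free_module_is_module) fact
  show ?thesis using assms(2)
  proof (induction S rule: infinite_finite_induct)
    case (insert i S)
    have h: "h \<in> S \<rightarrow> carrier (free_module K X)" "h i \<in> carrier (free_module K X)"
      using insert.prems by auto
    then have hx: "(\<lambda>i. h i x) \<in> S \<rightarrow> carrier K" "h i x \<in> carrier K"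
      by (auto simp: free_module_carrier Pi_def)
    have IH: "(\<Oplus>\<^bsub>free_module K X\<^esub>i\<in>S. h i) x = (\<Oplus>\<^bsub>K\<^esub>i\<in>S. h i x)"
      using insert.prems by (intro insert.IH) auto
    show ?case
      unfolding F.finsum_insert[OF insert.hyps h] K.finsum_insert[OF insert.hyps hx] by (simp add: IH)
  qed simp_all
qed

lemma free_module_expand:
  assumes "cring K" "f \<in> carrier (free_module K X)"
  shows "f = (\<Oplus>\<^bsub>free_module K X\<^esub>p\<in>{p. f p \<noteq> \<zero>\<^bsub>K\<^esub>}. f p \<odot>\<^bsub>free_module K X\<^esub> free_gen K p)"
proof
  interpret K: cring K by fact
  interpret F: module K "free_module K X" by (rule free_module_is_module) fact
  fix x
  let ?S = "{p. f p \<noteq> \<zero>\<^bsub>K\<^esub>}"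
  have f: "f p \<in> carrier K" "finite ?S" for p using assms(2) by (auto simp: free_module_carrier)
  have "(\<Oplus>\<^bsub>free_module K X\<^esub>p\<in>?S. f p \<odot>\<^bsub>free_module K X\<^esub> free_gen K p) x =
      (\<Oplus>\<^bsub>K\<^esub>p\<in>?S. (f p \<odot>\<^bsub>free_module K X\<^esub> free_gen K p) x)"
    using assms(2) f
    by (intro finsum_free_module_apply[OF assms(1)] F.smult_closed free_gen_closed[OF assms(1)])
       (auto simp: free_module_carrier)
  also have "\<dots> = (\<Oplus>\<^bsub>K\<^esub>p\<in>?S. if x = p then f p else \<zero>\<^bsub>K\<^esub>)"
    using f by (intro K.finsum_cong') (auto simp: free_gen_def)
  also have "\<dots> = f x"
  proof (cases "x \<in> ?S")
    case True
    then show ?thesis using f by (intro K.finsum_singleton) auto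
  next
    case False
    then have "(\<Oplus>\<^bsub>K\<^esub>p\<in>?S. if x = p then f p else \<zero>\<^bsub>K\<^esub>) = (\<Oplus>\<^bsub>K\<^esub>p\<in>?S. \<zero>\<^bsub>K\<^esub>)"
      by (intro K.finsum_cong') auto
    then show ?thesis using False by simp
  qed
  finally show "f x = (\<Oplus>\<^bsub>free_module K X\<^esub>p\<in>?S. f p \<odot>\<^bsub>free_module K X\<^esub> free_gen K p) x" by simp
qed

definition linear_extension ::
  "('k, 'r) ring_scheme \<Rightarrow> ('k, 'c) module \<Rightarrow> ('x \<Rightarrow> 'c) \<Rightarrow> ('x \<Rightarrow> 'k) \<Rightarrow> 'c" where
  "linear_extension K P \<phi> f = (\<Oplus>\<^bsub>P\<^esub>p\<in>{p. f p \<noteq> \<zero>\<^bsub>K\<^esub>}. f p \<odot>\<^bsub>P\<^esub> \<phi> p)"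

lemma linear_extension_eq:
  assumes "module K P" "f \<in> carrier (free_module K X)" "\<phi> \<in> X \<rightarrow> carrier P"
    and "finite S" "{p. f p \<noteq> \<zero>\<^bsub>K\<^esub>} \<subseteq> S" "S \<subseteq> X"
  shows "linear_extension K P \<phi> f = (\<Oplus>\<^bsub>P\<^esub>p\<in>S. f p \<odot>\<^bsub>P\<^esub> \<phi> p)"
proof -
  interpret P: module K P by fact
  show ?thesis
    unfolding linear_extension_def using assms
    by (intro P.add.finprod_mono_neutral_cong_left) (auto simp: free_module_carrier Pi_def subset_iff)
qed

lemma linear_extension_hom:
  assumes "module K P" "\<phi> \<in> X \<rightarrow> carrier P"
  shows "linear_extension K P \<phi> \<in> module_hom K (free_module K X) P"
proof -
  interpret P: module K P by fact
  interpret F: module K "free_module K X" by (rule free_module_is_module) (rule P.R.is_cring)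
  have fin: "finite {p. f p \<noteq> \<zero>\<^bsub>K\<^esub>}" "{p. f p \<noteq> \<zero>\<^bsub>K\<^esub>} \<subseteq> X" "f p \<in> carrier K"
    if "f \<in> carrier (free_module K X)" for f p using that by (auto simp: free_module_carrier)
  have cl: "f p \<odot>\<^bsub>P\<^esub> \<phi> p \<in> carrier P" if "f \<in> carrier (free_module K X)" "p \<in> X" for f p
    using that assms(2) by (auto simp: free_module_carrier)
  show ?thesis
  proof (rule module_homI)
    fix f assume f: "f \<in> carrier (free_module K X)"
    show "linear_extension K P \<phi> f \<in> carrier P"
      unfolding linear_extension_def using f fin[OF f] cl[OF f] by (intro P.finsum_closed) auto
    fix r assume r: "r \<in> carrier K"
    have rf: "r \<odot>\<^bsub>free_module K X\<^esub> f \<in> carrier (free_module K X)" using r f by (rule F.smult_closed)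
    have "linear_extension K P \<phi> (r \<odot>\<^bsub>free_module K X\<^esub> f) =
        (\<Oplus>\<^bsub>P\<^esub>p\<in>{p. f p \<noteq> \<zero>\<^bsub>K\<^esub>}. (r \<odot>\<^bsub>free_module K X\<^esub> f) p \<odot>\<^bsub>P\<^esub> \<phi> p)"
      using rf fin[OF f] assms r by (intro linear_extension_eq) auto
    also have "\<dots> = (\<Oplus>\<^bsub>P\<^esub>p\<in>{p. f p \<noteq> \<zero>\<^bsub>K\<^esub>}. r \<odot>\<^bsub>P\<^esub> (f p \<odot>\<^bsub>P\<^esub> \<phi> p))"
      using fin[OF f] cl[OF f] r assms(2)
      by (intro P.finsum_cong') (auto simp: P.smult_assoc1 subset_iff Pi_def)
    also have "\<dots> = r \<odot>\<^bsub>P\<^esub> linear_extension K P \<phi> f"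
      unfolding linear_extension_def using fin[OF f] cl[OF f] r
      by (intro P.finsum_smult_ldistr[symmetric]) auto
    finally show "linear_extension K P \<phi> (r \<odot>\<^bsub>free_module K X\<^esub> f) = r \<odot>\<^bsub>P\<^esub> linear_extension K P \<phi> f" .
  next
    fix f g assume f: "f \<in> carrier (free_module K X)" and g: "g \<in> carrier (free_module K X)"
    let ?S = "{p. f p \<noteq> \<zero>\<^bsub>K\<^esub>} \<union> {p. g p \<noteq> \<zero>\<^bsub>K\<^esub>}"
    have S: "finite ?S" "?S \<subseteq> X" using fin[OF f] fin[OF g] by auto
    have fg: "f \<oplus>\<^bsub>free_module K X\<^esub> g \<in> carrier (free_module K X)" using f g by (rule F.a_closed)
    have "linear_extension K P \<phi> (f \<oplus>\<^bsub>free_module K X\<^esub> g) =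
        (\<Oplus>\<^bsub>P\<^esub>p\<in>?S. (f \<oplus>\<^bsub>free_module K X\<^esub> g) p \<odot>\<^bsub>P\<^esub> \<phi> p)"
      using fg S assms by (intro linear_extension_eq) auto
    also have "\<dots> = (\<Oplus>\<^bsub>P\<^esub>p\<in>?S. f p \<odot>\<^bsub>P\<^esub> \<phi> p \<oplus>\<^bsub>P\<^esub> g p \<odot>\<^bsub>P\<^esub> \<phi> p)"
      using fin[OF f] fin[OF g] cl[OF f] cl[OF g] assms(2)
      by (intro P.finsum_cong') (auto simp: P.smult_l_distr subset_iff Pi_def)
    also have "\<dots> = (\<Oplus>\<^bsub>P\<^esub>p\<in>?S. f p \<odot>\<^bsub>P\<^esub> \<phi> p) \<oplus>\<^bsub>P\<^esub> (\<Oplus>\<^bsub>P\<^esub>p\<in>?S. g p \<odot>\<^bsub>P\<^esub> \<phi> p)"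
      using S cl[OF f] cl[OF g] by (intro P.finsum_addf) auto
    also have "(\<Oplus>\<^bsub>P\<^esub>p\<in>?S. f p \<odot>\<^bsub>P\<^esub> \<phi> p) = linear_extension K P \<phi> f"
      using S f assms by (intro linear_extension_eq[symmetric]) auto
    also have "(\<Oplus>\<^bsub>P\<^esub>p\<in>?S. g p \<odot>\<^bsub>P\<^esub> \<phi> p) = linear_extension K P \<phi> g"
      using S g assms by (intro linear_extension_eq[symmetric]) auto
    finally show "linear_extension K P \<phi> (f \<oplus>\<^bsub>free_module K X\<^esub> g) =
        linear_extension K P \<phi> f \<oplus>\<^bsub>P\<^esub> linear_extension K P \<phi> g" .
  qed
qed

lemma linear_extension_free_gen:
  assumes "module K P" "\<phi> \<in> X \<rightarrow> carrier P" "x \<in> X"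
  shows "linear_extension K P \<phi> (free_gen K x) = \<phi> x"
proof -
  interpret P: module K P by fact
  have "\<phi> x \<in> carrier P" using assms by auto
  moreover have "linear_extension K P \<phi> (free_gen K x) = (\<Oplus>\<^bsub>P\<^esub>p\<in>{x}. free_gen K x p \<odot>\<^bsub>P\<^esub> \<phi> p)"
    using assms(3) by (intro linear_extension_eq[OF assms(1) _ assms(2)] free_gen_closed P.R.is_cring)
      (auto simp: free_gen_def)
  ultimately show ?thesis by (simp add: free_gen_def P.finsum_insert P.finsum_empty Pi_def)
qed

lemma quotient_module_simps [simp]:
  "carrier (quotient_module K M H) = a_rcosets\<^bsub>M\<^esub> H"
  "zero (quotient_module K M H) = H"
  "add (quotient_module K M H) = set_add M"
  by (simp_all add: quotient_module_def)

locale quotient = module K M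
  for K :: "('k, 'r) ring_scheme" (structure) and M :: "('k, 'a) module" (structure) +
  fixes H :: "'a set"
  assumes submodule: "submodule H K M"
begin

sublocale H: submodule H K M by (rule submodule)

sublocale S: abelian_subgroup H M
  by (intro abelian_subgroupI3 additive_subgroup.intro H.subgroup_axioms M.abelian_group_axioms)

lemma smult_coset:
  assumes "r \<in> carrier K" "x \<in> carrier M"
  shows "r \<odot>\<^bsub>quotient_module K M H\<^esub> (H +>\<^bsub>M\<^esub> x) = H +>\<^bsub>M\<^esub> (r \<odot>\<^bsub>M\<^esub> x)"
proof -
  have "H +>\<^bsub>M\<^esub> (r \<odot>\<^bsub>M\<^esub> y) = H +>\<^bsub>M\<^esub> (r \<odot>\<^bsub>M\<^esub> x)" if "y \<in> H +>\<^bsub>M\<^esub> x" for y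
  proof -
    obtain h where h: "h \<in> H" "y = h \<oplus>\<^bsub>M\<^esub> x" using \<open>y \<in> H +>\<^bsub>M\<^esub> x\<close> by (auto simp: a_r_coset_def')
    then have "h \<in> carrier M" using S.a_subset by auto
    then have "r \<odot>\<^bsub>M\<^esub> y = r \<odot>\<^bsub>M\<^esub> h \<oplus>\<^bsub>M\<^esub> r \<odot>\<^bsub>M\<^esub> x" using h assms smult_r_distr by auto
    then have "r \<odot>\<^bsub>M\<^esub> y \<in> H +>\<^bsub>M\<^esub> (r \<odot>\<^bsub>M\<^esub> x)" using h assms by (auto simp: a_r_coset_def')
    then show ?thesis using assms by (intro M.a_repr_independence[symmetric] S.a_subgroup) auto
  qed
  moreover have "x \<in> H +>\<^bsub>M\<^esub> x" using assms by (intro S.a_rcos_self)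
  ultimately show ?thesis
    unfolding quotient_module_def module.simps by (intro UN_constant_eq ballI)
qed

lemma coset_cases:
  assumes "X \<in> carrier (quotient_module K M H)"
  obtains x where "x \<in> carrier M" "X = H +>\<^bsub>M\<^esub> x"
  using assms by (auto simp: A_RCOSETS_def')

lemma coset_closed: "x \<in> carrier M \<Longrightarrow> H +>\<^bsub>M\<^esub> x \<in> carrier (quotient_module K M H)"
  by (auto simp: A_RCOSETS_def')

lemma module_quotient: "module K (quotient_module K M H)"
proof (rule moduleI)
  interpret Q: comm_group "M A_Mod H" by (rule S.a_factorgroup_is_comm_group)
  show "abelian_group (quotient_module K M H)"
  proof (rule abelian_groupI)
    note A = A_FactGroup_def' monoid.simps partial_object.simps
    note [simp] = Q.m_closed[unfolded A] Q.one_closed[unfolded A] Q.l_one[unfolded A]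
    fix X Y Z assume X: "X \<in> carrier (quotient_module K M H)"
      and Y: "Y \<in> carrier (quotient_module K M H)" and Z: "Z \<in> carrier (quotient_module K M H)"
    show "X \<oplus>\<^bsub>quotient_module K M H\<^esub> Y \<oplus>\<^bsub>quotient_module K M H\<^esub> Z =
        X \<oplus>\<^bsub>quotient_module K M H\<^esub> (Y \<oplus>\<^bsub>quotient_module K M H\<^esub> Z)"
      using X Y Z Q.m_assoc[unfolded A] by simp
    show "X \<oplus>\<^bsub>quotient_module K M H\<^esub> Y = Y \<oplus>\<^bsub>quotient_module K M H\<^esub> X"
      using X Y Q.m_comm[unfolded A, of X Y] by simp
    show "\<exists>Y\<in>carrier (quotient_module K M H). Y \<oplus>\<^bsub>quotient_module K M H\<^esub> X = \<zero>\<^bsub>quotient_module K M H\<^esub>"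
      using X Q.l_inv_ex[unfolded A, of X] by simp
    show "X \<oplus>\<^bsub>quotient_module K M H\<^esub> Y \<in> carrier (quotient_module K M H)"
      "\<zero>\<^bsub>quotient_module K M H\<^esub> \<oplus>\<^bsub>quotient_module K M H\<^esub> X = X"
      using X Y by simp_all
  next
    show "\<zero>\<^bsub>quotient_module K M H\<^esub> \<in> carrier (quotient_module K M H)"
      using Q.one_closed unfolding A_FactGroup_def' by simp
  qed
  show "cring K" by (rule R.is_cring)
next
  fix r X assume "r \<in> carrier K" "X \<in> carrier (quotient_module K M H)"
  then show "r \<odot>\<^bsub>quotient_module K M H\<^esub> X \<in> carrier (quotient_module K M H)"
    by (metis coset_cases smult_coset coset_closed smult_closed)
next
  fix r s X assume "r \<in> carrier K" "s \<in> carrier K" "X \<in> carrier (quotient_module K M H)"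
  then show "(r \<oplus>\<^bsub>K\<^esub> s) \<odot>\<^bsub>quotient_module K M H\<^esub> X =
      r \<odot>\<^bsub>quotient_module K M H\<^esub> X \<oplus>\<^bsub>quotient_module K M H\<^esub> s \<odot>\<^bsub>quotient_module K M H\<^esub> X"
    by (elim coset_cases) (auto simp: smult_coset S.a_rcos_sum smult_l_distr)
next
  fix r X Y assume "r \<in> carrier K" "X \<in> carrier (quotient_module K M H)" "Y \<in> carrier (quotient_module K M H)"
  then show "r \<odot>\<^bsub>quotient_module K M H\<^esub> (X \<oplus>\<^bsub>quotient_module K M H\<^esub> Y) =
      r \<odot>\<^bsub>quotient_module K M H\<^esub> X \<oplus>\<^bsub>quotient_module K M H\<^esub> r \<odot>\<^bsub>quotient_module K M H\<^esub> Y"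
    by (elim coset_cases) (auto simp: smult_coset S.a_rcos_sum smult_r_distr)
next
  fix r s X assume "r \<in> carrier K" "s \<in> carrier K" "X \<in> carrier (quotient_module K M H)"
  then show "(r \<otimes>\<^bsub>K\<^esub> s) \<odot>\<^bsub>quotient_module K M H\<^esub> X =
      r \<odot>\<^bsub>quotient_module K M H\<^esub> (s \<odot>\<^bsub>quotient_module K M H\<^esub> X)"
    by (elim coset_cases) (auto simp: smult_coset smult_assoc1)
next
  fix X assume "X \<in> carrier (quotient_module K M H)"
  then show "\<one>\<^bsub>K\<^esub> \<odot>\<^bsub>quotient_module K M H\<^esub> X = X"
    by (elim coset_cases) (auto simp: smult_coset)
qed

lemma coset_hom: "(\<lambda>x. H +>\<^bsub>M\<^esub> x) \<in> module_hom K M (quotient_module K M H)"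
  using coset_closed by (intro module_homI) (auto simp: smult_coset S.a_rcos_sum)

end

lemma submodule_span_is_submodule:
  assumes "module K M" "S \<subseteq> carrier M"
  shows "submodule (submodule_span K M S) K M"
proof -
  interpret M: module K M by fact
  note E = M.submoduleE
  have z: "\<zero>\<^bsub>M\<^esub> \<in> H" if "submodule H K M" for H
    using subgroup.one_closed[OF submodule.axioms(1)[OF that]] by simp
  show ?thesis
  proof (rule M.submoduleI)
    show "submodule_span K M S \<subseteq> carrier M"
      using M.carrier_is_submodule assms(2) by (auto simp: submodule_span_def)
  qed (auto simp: submodule_span_def z E)
qed

lemma submodule_span_superset: "S \<subseteq> submodule_span K M S"
  by (auto simp: submodule_span_def)

lemma submodule_span_minimal: "\<lbrakk>submodule H K M; S \<subseteq> H\<rbrakk> \<Longrightarrow> submodule_span K M S \<subseteq> H"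
  by (auto simp: submodule_span_def)

definition bilinear ::
  "('k, 'r) ring_scheme \<Rightarrow> ('k, 'a) module \<Rightarrow> ('k, 'b) module \<Rightarrow> ('k, 'c) module \<Rightarrow> ('a \<Rightarrow> 'b \<Rightarrow> 'c) \<Rightarrow> bool"
  where
  "bilinear K M N P \<phi> \<longleftrightarrow>
    (\<forall>n\<in>carrier N. (\<lambda>m. \<phi> m n) \<in> module_hom K M P) \<and>
    (\<forall>m\<in>carrier M. (\<lambda>n. \<phi> m n) \<in> module_hom K N P)"

lemma bilinearD:
  assumes "bilinear K M N P \<phi>"
  shows "n \<in> carrier N \<Longrightarrow> (\<lambda>m. \<phi> m n) \<in> module_hom K M P"
    and "m \<in> carrier M \<Longrightarrow> (\<lambda>n. \<phi> m n) \<in> module_hom K N P"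
    and "\<lbrakk>m \<in> carrier M; n \<in> carrier N\<rbrakk> \<Longrightarrow> \<phi> m n \<in> carrier P"
  using assms by (auto simp: bilinear_def module_hom_def)

section \<open>The universal property of the tensor product\<close>

locale two_modules = M: module K M + N: module K N
  for K :: "('k, 'r) ring_scheme" and M :: "('k, 'm) module" and N :: "('k, 'n) module"
begin

abbreviation "F \<equiv> free_module K (carrier M \<times> carrier N)"

sublocale F: module K F
  by (rule free_module_is_module) (rule M.R.is_cring)

lemma free_gen_in: "\<lbrakk>m \<in> carrier M; n \<in> carrier N\<rbrakk> \<Longrightarrow> free_gen K (m, n) \<in> carrier F"
  by (intro free_gen_closed M.R.is_cring) auto

lemma bilinear_relations_subset: "bilinear_relations K M N \<subseteq> carrier F"
  unfolding bilinear_relations_def Let_def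
  by (auto simp del: free_module_simps
      intro!: F.minus_closed F.a_closed F.smult_closed free_gen_in)

sublocale Q: quotient K F "tensor_relations K M N"
  unfolding tensor_relations_def
  by (intro quotient.intro quotient_axioms.intro submodule_span_is_submodule
      bilinear_relations_subset F.module_axioms)

lemma module_tensor: "module K (tensor K M N)"
  using Q.module_quotient by (simp add: tensor_def)

sublocale T: module K "tensor K M N" by (rule module_tensor)

lemma tensor_cases:
  assumes "x \<in> carrier (tensor K M N)"
  obtains f where "f \<in> carrier F" "x = tensor_relations K M N +>\<^bsub>F\<^esub> f"
  using assms Q.coset_cases unfolding tensor_def by blast

lemma coset_hom_tensor: "(\<lambda>f. tensor_relations K M N +>\<^bsub>F\<^esub> f) \<in> module_hom K F (tensor K M N)"
  using Q.coset_hom by (simp add: tensor_def)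

lemma pure_tensor_closed: "\<lbrakk>m \<in> carrier M; n \<in> carrier N\<rbrakk> \<Longrightarrow> pure_tensor K M N m n \<in> carrier (tensor K M N)"
  unfolding pure_tensor_def by (intro module_homD(1)[OF coset_hom_tensor] free_gen_in)

lemma relation_coset:
  assumes "f \<in> carrier F" "g \<in> carrier F" "f \<ominus>\<^bsub>F\<^esub> g \<in> bilinear_relations K M N"
  shows "tensor_relations K M N +>\<^bsub>F\<^esub> f = tensor_relations K M N +>\<^bsub>F\<^esub> g"
proof -
  have "f \<ominus>\<^bsub>F\<^esub> g \<in> tensor_relations K M N"
    unfolding tensor_relations_def by (rule subsetD[OF submodule_span_superset assms(3)])
  then have "f \<in> tensor_relations K M N +>\<^bsub>F\<^esub> g"
    using assms by (intro Q.S.a_rcos_module_rev) (simp_all add: a_minus_def del: free_module_simps)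
  then show ?thesis using assms by (intro F.a_repr_independence[symmetric] Q.S.a_subgroup) auto
qed

lemma bilinear_pure_tensor: "bilinear K M N (tensor K M N) (pure_tensor K M N)"
proof -
  let ?q = "\<lambda>f. tensor_relations K M N +>\<^bsub>F\<^esub> f"
  note q = module_homD[OF coset_hom_tensor]
  note closed = free_gen_in M.smult_closed N.smult_closed M.a_closed N.a_closed F.smult_closed F.a_closed
  show ?thesis unfolding bilinear_def
  proof (intro conjI ballI module_homI)
    fix m m' n assume "m \<in> carrier M" "m' \<in> carrier M" "n \<in> carrier N"
    note mn = this
    have "?q (free_gen K (m \<oplus>\<^bsub>M\<^esub> m', n)) = ?q (free_gen K (m, n) \<oplus>\<^bsub>F\<^esub> free_gen K (m', n))"
      using mn by (intro relation_coset closed) (auto simp: bilinear_relations_def Let_def)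
    then show "pure_tensor K M N (m \<oplus>\<^bsub>M\<^esub> m') n =
        pure_tensor K M N m n \<oplus>\<^bsub>tensor K M N\<^esub> pure_tensor K M N m' n"
      unfolding pure_tensor_def using q(2)[OF free_gen_in free_gen_in, of m n m' n] mn by simp
  next
    fix m n n' assume "m \<in> carrier M" "n \<in> carrier N" "n' \<in> carrier N"
    note mn = this
    have "?q (free_gen K (m, n \<oplus>\<^bsub>N\<^esub> n')) = ?q (free_gen K (m, n) \<oplus>\<^bsub>F\<^esub> free_gen K (m, n'))"
      using mn by (intro relation_coset closed) (auto simp: bilinear_relations_def Let_def)
    then show "pure_tensor K M N m (n \<oplus>\<^bsub>N\<^esub> n') =
        pure_tensor K M N m n \<oplus>\<^bsub>tensor K M N\<^esub> pure_tensor K M N m n'"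
      unfolding pure_tensor_def using q(2)[OF free_gen_in free_gen_in, of m n m n'] mn by simp
  next
    fix r m n assume "r \<in> carrier K" "m \<in> carrier M" "n \<in> carrier N"
    note mn = this
    have "?q (free_gen K (r \<odot>\<^bsub>M\<^esub> m, n)) = ?q (r \<odot>\<^bsub>F\<^esub> free_gen K (m, n))"
      using mn by (intro relation_coset closed) (auto simp: bilinear_relations_def Let_def)
    then show "pure_tensor K M N (r \<odot>\<^bsub>M\<^esub> m) n = r \<odot>\<^bsub>tensor K M N\<^esub> pure_tensor K M N m n"
      unfolding pure_tensor_def using q(3)[OF _ free_gen_in, of r m n] mn by simp
    have "?q (free_gen K (m, r \<odot>\<^bsub>N\<^esub> n)) = ?q (r \<odot>\<^bsub>F\<^esub> free_gen K (m, n))"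
      using mn by (intro relation_coset closed) (auto simp: bilinear_relations_def Let_def)
    then show "pure_tensor K M N m (r \<odot>\<^bsub>N\<^esub> n) = r \<odot>\<^bsub>tensor K M N\<^esub> pure_tensor K M N m n"
      unfolding pure_tensor_def using q(3)[OF _ free_gen_in, of r m n] mn by simp
  qed (auto intro: pure_tensor_closed)
qed

definition rep :: "('k, 'm, 'n) tensor \<Rightarrow> 'm \<times> 'n \<Rightarrow> 'k" where
  "rep x = (SOME f. f \<in> x)"

lemma tensor_lift_rep:
  "tensor_lift K P \<phi> x = linear_extension K P (\<lambda>p. \<phi> (fst p) (snd p)) (rep x)"
  by (simp add: tensor_lift_def linear_extension_def rep_def Let_def)

lemma rep:
  assumes "x \<in> carrier (tensor K M N)"
  shows "rep x \<in> carrier F" "x = tensor_relations K M N +>\<^bsub>F\<^esub> rep x"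
proof -
  obtain f where f: "f \<in> carrier F" "x = tensor_relations K M N +>\<^bsub>F\<^esub> f"
    using assms by (rule tensor_cases)
  then have "f \<in> x" using Q.S.a_rcos_self by blast
  then have x: "rep x \<in> x" unfolding rep_def by (metis someI)
  show "rep x \<in> carrier F"
    using f(1) x Q.S.a_elemrcos_carrier unfolding f(2) by blast
  show "x = tensor_relations K M N +>\<^bsub>F\<^esub> rep x"
    using f x by (metis F.a_repr_independence Q.S.a_subgroup)
qed

lemma rep_coeff:
  assumes "x \<in> carrier (tensor K M N)"
  shows "rep x p \<in> carrier K" "rep x p \<noteq> \<zero>\<^bsub>K\<^esub> \<Longrightarrow> p \<in> carrier M \<times> carrier N"
    "finite {p. rep x p \<noteq> \<zero>\<^bsub>K\<^esub>}"
  using rep(1)[OF assms] unfolding free_module_carrier by blast+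

lemma tensor_lift_coset:
  assumes "module K P" "bilinear K M N P \<phi>" "f \<in> carrier F"
  shows "tensor_lift K P \<phi> (tensor_relations K M N +>\<^bsub>F\<^esub> f) =
    linear_extension K P (\<lambda>p. \<phi> (fst p) (snd p)) f"
proof -
  interpret P: module K P by fact
  let ?L = "linear_extension K P (\<lambda>p. \<phi> (fst p) (snd p))"
  have \<phi>: "(\<lambda>p. \<phi> (fst p) (snd p)) \<in> carrier M \<times> carrier N \<rightarrow> carrier P"
    using bilinearD(3)[OF assms(2)] by auto
  have L: "?L \<in> module_hom K F P"
    by (rule linear_extension_hom[OF assms(1) \<phi>])
  note Lg = linear_extension_free_gen[OF assms(1) \<phi>]
  have Lm: "?L (f \<ominus>\<^bsub>F\<^esub> g) = \<zero>\<^bsub>P\<^esub>" if "f \<in> carrier F" "g \<in> carrier F" "?L f = ?L g" for f g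
  proof -
    have "?L (f \<ominus>\<^bsub>F\<^esub> g) \<oplus>\<^bsub>P\<^esub> ?L g = ?L ((f \<ominus>\<^bsub>F\<^esub> g) \<oplus>\<^bsub>F\<^esub> g)"
      using that by (intro module_homD(2)[OF L, symmetric] F.minus_closed)
    also have "(f \<ominus>\<^bsub>F\<^esub> g) \<oplus>\<^bsub>F\<^esub> g = f"
      using that by (simp add: a_minus_def F.a_assoc F.l_neg del: free_module_simps)
    finally have "?L (f \<ominus>\<^bsub>F\<^esub> g) \<oplus>\<^bsub>P\<^esub> ?L g = ?L g" by (simp only: that(3))
    then show ?thesis
      using module_homD(1)[OF L that(2)] module_homD(1)[OF L F.minus_closed[OF that(1,2)]] by simp
  qed
  note b1 = module_homD[OF bilinearD(1)[OF assms(2)]] and b2 = module_homD[OF bilinearD(2)[OF assms(2)]]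
  note closed = free_gen_in M.smult_closed N.smult_closed M.a_closed N.a_closed F.smult_closed F.a_closed
  have "bilinear_relations K M N \<subseteq> {f \<in> carrier F. ?L f = \<zero>\<^bsub>P\<^esub>}"
  proof
    fix h assume h: "h \<in> bilinear_relations K M N"
    have "?L h = \<zero>\<^bsub>P\<^esub>"
      by (insert h, unfold bilinear_relations_def Let_def, elim UnE CollectE exE conjE;
          (hypsubst, rule Lm;
            simp add: module_homD(2,3)[OF L] closed Lg b1(2,3) b2(2,3) del: free_module_simps))
    then show "h \<in> {f \<in> carrier F. ?L f = \<zero>\<^bsub>P\<^esub>}" using h bilinear_relations_subset by auto
  qed
  then have ker: "tensor_relations K M N \<subseteq> {f \<in> carrier F. ?L f = \<zero>\<^bsub>P\<^esub>}"
    unfolding tensor_relations_def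
    by (intro submodule_span_minimal module_hom_kernel[OF F.module_axioms assms(1) L])
  define x where "x = tensor_relations K M N +>\<^bsub>F\<^esub> f"
  have x: "x \<in> carrier (tensor K M N)"
    unfolding x_def by (rule module_homD(1)[OF coset_hom_tensor assms(3)])
  have "rep x \<in> tensor_relations K M N +>\<^bsub>F\<^esub> f"
    using Q.S.a_rcos_self[OF rep(1)[OF x]] unfolding rep(2)[OF x, symmetric] by (simp add: x_def)
  then obtain h where h: "h \<in> tensor_relations K M N" "rep x = h \<oplus>\<^bsub>F\<^esub> f"
    by (auto simp: a_r_coset_def' simp del: free_module_simps)
  with ker have "?L (rep x) = ?L f"
    using assms(3) module_homD(1)[OF L assms(3)] by (auto simp: module_homD(2)[OF L] simp del: free_module_simps)
  then show ?thesis by (simp add: tensor_lift_rep x_def)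
qed

lemma tensor_lift_hom:
  assumes "module K P" "bilinear K M N P \<phi>"
  shows "tensor_lift K P \<phi> \<in> module_hom K (tensor K M N) P"
proof -
  have "(\<lambda>p. \<phi> (fst p) (snd p)) \<in> carrier M \<times> carrier N \<rightarrow> carrier P"
    using bilinearD(3)[OF assms(2)] by auto
  note L = module_homD[OF linear_extension_hom[OF assms(1) this]]
  note q = module_homD[OF coset_hom_tensor]
  show ?thesis
  proof (rule module_homI)
    fix x assume "x \<in> carrier (tensor K M N)"
    then show "tensor_lift K P \<phi> x \<in> carrier P"
      by (auto elim!: tensor_cases simp: tensor_lift_coset[OF assms] L)
    fix r assume r: "r \<in> carrier K"
    from \<open>x \<in> carrier (tensor K M N)\<close> obtain f
      where f: "f \<in> carrier F" "x = tensor_relations K M N +>\<^bsub>F\<^esub> f" by (rule tensor_cases)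
    show "tensor_lift K P \<phi> (r \<odot>\<^bsub>tensor K M N\<^esub> x) = r \<odot>\<^bsub>P\<^esub> tensor_lift K P \<phi> x"
      unfolding f(2) q(3)[OF r f(1), symmetric] using r f(1)
      by (simp add: tensor_lift_coset[OF assms] L F.smult_closed del: free_module_simps)
  next
    fix x y assume "x \<in> carrier (tensor K M N)" "y \<in> carrier (tensor K M N)"
    then obtain f g where f: "f \<in> carrier F" "x = tensor_relations K M N +>\<^bsub>F\<^esub> f"
      and g: "g \<in> carrier F" "y = tensor_relations K M N +>\<^bsub>F\<^esub> g" by (elim tensor_cases) 
    show "tensor_lift K P \<phi> (x \<oplus>\<^bsub>tensor K M N\<^esub> y) = tensor_lift K P \<phi> x \<oplus>\<^bsub>P\<^esub> tensor_lift K P \<phi> y"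
      unfolding f(2) g(2) q(2)[OF f(1) g(1), symmetric] using f(1) g(1)
      by (simp add: tensor_lift_coset[OF assms] L F.a_closed del: free_module_simps)
  qed
qed

lemma tensor_lift_pure_tensor:
  assumes "module K P" "bilinear K M N P \<phi>" "m \<in> carrier M" "n \<in> carrier N"
  shows "tensor_lift K P \<phi> (pure_tensor K M N m n) = \<phi> m n"
proof -
  have "(\<lambda>p. \<phi> (fst p) (snd p)) \<in> carrier M \<times> carrier N \<rightarrow> carrier P"
    using bilinearD(3)[OF assms(2)] by auto
  from linear_extension_free_gen[OF assms(1) this, of "(m, n)"] show ?thesis
    unfolding pure_tensor_def using assms(3,4) by (simp add: tensor_lift_coset[OF assms(1,2)] free_gen_in)
qed

lemma tensor_lift_closed:
  assumes "module K P" "\<And>m n. \<lbrakk>m \<in> carrier M; n \<in> carrier N\<rbrakk> \<Longrightarrow> \<phi> m n \<in> carrier P"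
    and "x \<in> carrier (tensor K M N)"
  shows "tensor_lift K P \<phi> x \<in> carrier P"
proof -
  have "(\<lambda>p. \<phi> (fst p) (snd p)) \<in> carrier M \<times> carrier N \<rightarrow> carrier P"
    using assms(2) by auto
  from module_homD(1)[OF linear_extension_hom[OF assms(1) this] rep(1)[OF assms(3)]]
  show ?thesis by (simp add: tensor_lift_rep)
qed

lemma module_hom_tensor_lift:
  assumes "module K P" "module K P'" "g \<in> module_hom K P P'"
    and "\<And>m n. \<lbrakk>m \<in> carrier M; n \<in> carrier N\<rbrakk> \<Longrightarrow> \<phi> m n \<in> carrier P"
    and "x \<in> carrier (tensor K M N)"
  shows "g (tensor_lift K P \<phi> x) = tensor_lift K P' (\<lambda>m n. g (\<phi> m n)) x"
proof -
  interpret P: module K P by fact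
  interpret P': module K P' by fact
  note f = rep_coeff[OF assms(5)]
  have \<phi>: "\<phi> (fst p) (snd p) \<in> carrier P" if "rep x p \<noteq> \<zero>\<^bsub>K\<^esub>" for p
    using f(2)[OF that] assms(4) by auto
  show ?thesis
    unfolding tensor_lift_rep linear_extension_def
    using f(1) \<phi> module_homD(1)[OF assms(3)]
    by (subst module_hom_finsum[OF assms(1-3)])
      (auto intro!: P'.finsum_cong' simp: module_homD(3)[OF assms(3)])
qed

lemma tensor_lift_cong:
  assumes "module K P" "\<And>m n. \<lbrakk>m \<in> carrier M; n \<in> carrier N\<rbrakk> \<Longrightarrow> \<phi> m n = \<psi> m n"
    and "\<And>m n. \<lbrakk>m \<in> carrier M; n \<in> carrier N\<rbrakk> \<Longrightarrow> \<psi> m n \<in> carrier P"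
    and "x \<in> carrier (tensor K M N)"
  shows "tensor_lift K P \<phi> x = tensor_lift K P \<psi> x"
proof -
  interpret P: module K P by fact
  note f = rep_coeff[OF assms(4)]
  show ?thesis
    unfolding tensor_lift_rep linear_extension_def using f assms(2,3)
    by (intro P.finsum_cong') (auto simp: mem_Times_iff)
qed

lemma tensor_lift_pure_tensor_id:
  assumes x: "x \<in> carrier (tensor K M N)"
  shows "tensor_lift K (tensor K M N) (pure_tensor K M N) x = x"
proof -
  note f = rep(1)[OF x]
  note f' = rep_coeff[OF x]
  have g: "rep x p \<odot>\<^bsub>F\<^esub> free_gen K p \<in> carrier F" if "rep x p \<noteq> \<zero>\<^bsub>K\<^esub>" for p
    using f'(1) f'(2)[OF that] by (auto intro!: F.smult_closed free_gen_in simp del: free_module_simps)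
  have "x = tensor_relations K M N +>\<^bsub>F\<^esub> (\<Oplus>\<^bsub>F\<^esub>p\<in>{p. rep x p \<noteq> \<zero>\<^bsub>K\<^esub>}. rep x p \<odot>\<^bsub>F\<^esub> free_gen K p)"
    using rep(2)[OF x] free_module_expand[OF M.R.is_cring f] by simp
  also have "\<dots> = (\<Oplus>\<^bsub>tensor K M N\<^esub>p\<in>{p. rep x p \<noteq> \<zero>\<^bsub>K\<^esub>}.
      tensor_relations K M N +>\<^bsub>F\<^esub> (rep x p \<odot>\<^bsub>F\<^esub> free_gen K p))"
    using g by (intro module_hom_finsum[OF F.module_axioms module_tensor coset_hom_tensor]) auto
  also have "\<dots> = tensor_lift K (tensor K M N) (pure_tensor K M N) x"
    unfolding tensor_lift_rep linear_extension_def using f' 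
    by (intro T.finsum_cong')
      (auto simp: pure_tensor_def module_homD(3)[OF coset_hom_tensor] free_gen_in
        intro!: T.smult_closed pure_tensor_closed[unfolded pure_tensor_def] simp del: free_module_simps)
  finally show ?thesis by simp
qed

lemma module_hom_tensor_lift_param:
  assumes "module K L" "module K P" "x \<in> carrier (tensor K M N)"
    and "\<And>m n. \<lbrakk>m \<in> carrier M; n \<in> carrier N\<rbrakk> \<Longrightarrow> (\<lambda>l. \<phi> l m n) \<in> module_hom K L P"
  shows "(\<lambda>l. tensor_lift K P (\<phi> l) x) \<in> module_hom K L P"
proof (rule module_homI)
  interpret L: module K L by fact
  interpret P: module K P by fact
  let ?S = "{p. rep x p \<noteq> \<zero>\<^bsub>K\<^esub>}"
  have f: "rep x p \<in> carrier K" "p \<in> ?S \<Longrightarrow> p \<in> carrier M \<times> carrier N" "finite ?S" for p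
    using rep_coeff[OF assms(3)] by auto
  note \<phi> = module_homD[OF assms(4)]
  fix l assume l: "l \<in> carrier L"
  show "tensor_lift K P (\<phi> l) x \<in> carrier P"
    using assms(1-3) l \<phi>(1) by (intro tensor_lift_closed) auto
  have c: "rep x p \<odot>\<^bsub>P\<^esub> \<phi> l (fst p) (snd p) \<in> carrier P" if "p \<in> ?S" for p
    using f(1) f(2)[OF that] \<phi>(1) l by auto
  fix r assume r: "r \<in> carrier K"
  have "rep x p \<odot>\<^bsub>P\<^esub> (r \<odot>\<^bsub>P\<^esub> \<phi> l (fst p) (snd p)) = r \<odot>\<^bsub>P\<^esub> (rep x p \<odot>\<^bsub>P\<^esub> \<phi> l (fst p) (snd p))"
    if "p \<in> ?S" for p
    using f(1) f(2)[OF that] \<phi>(1)[of "fst p" "snd p" l] r l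
    by (auto simp: P.smult_assoc1[symmetric] M.m_comm)
  then show "tensor_lift K P (\<phi> (r \<odot>\<^bsub>L\<^esub> l)) x = r \<odot>\<^bsub>P\<^esub> tensor_lift K P (\<phi> l) x"
    unfolding tensor_lift_rep linear_extension_def
    using f r l c \<phi>(3)
    by (subst P.finsum_smult_ldistr) (auto intro!: P.finsum_cong' simp: mem_Times_iff)
next
  interpret L: module K L by fact
  interpret P: module K P by fact
  let ?S = "{p. rep x p \<noteq> \<zero>\<^bsub>K\<^esub>}"
  have f: "rep x p \<in> carrier K" "p \<in> ?S \<Longrightarrow> p \<in> carrier M \<times> carrier N" "finite ?S" for p
    using rep_coeff[OF assms(3)] by auto
  note \<phi> = module_homD[OF assms(4)]
  fix l l' assume l: "l \<in> carrier L" "l' \<in> carrier L"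
  have c: "rep x p \<odot>\<^bsub>P\<^esub> \<phi> l (fst p) (snd p) \<in> carrier P" if "p \<in> ?S" "l \<in> carrier L" for p l
    using f(1) f(2)[OF that(1)] \<phi>(1) that(2) by auto
  have "(\<Oplus>\<^bsub>P\<^esub>p\<in>?S. rep x p \<odot>\<^bsub>P\<^esub> \<phi> (l \<oplus>\<^bsub>L\<^esub> l') (fst p) (snd p)) =
      (\<Oplus>\<^bsub>P\<^esub>p\<in>?S. rep x p \<odot>\<^bsub>P\<^esub> \<phi> l (fst p) (snd p) \<oplus>\<^bsub>P\<^esub> rep x p \<odot>\<^bsub>P\<^esub> \<phi> l' (fst p) (snd p))"
    using f l c \<phi>(1,2) by (intro P.finsum_cong') (auto simp: mem_Times_iff P.smult_r_distr)
  also have "\<dots> = (\<Oplus>\<^bsub>P\<^esub>p\<in>?S. rep x p \<odot>\<^bsub>P\<^esub> \<phi> l (fst p) (snd p)) \<oplus>\<^bsub>P\<^esub>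
      (\<Oplus>\<^bsub>P\<^esub>p\<in>?S. rep x p \<odot>\<^bsub>P\<^esub> \<phi> l' (fst p) (snd p))"
    using l c by (intro P.finsum_addf) auto
  finally show "tensor_lift K P (\<phi> (l \<oplus>\<^bsub>L\<^esub> l')) x = tensor_lift K P (\<phi> l) x \<oplus>\<^bsub>P\<^esub> tensor_lift K P (\<phi> l') x"
    unfolding tensor_lift_rep linear_extension_def .
qed

lemma tensor_lift_swap:
  assumes "module K P" "two_modules K M' N'" "x \<in> carrier (tensor K M N)" "y \<in> carrier (tensor K M' N')"
    and closed: "\<And>m n m' n'. \<lbrakk>m \<in> carrier M; n \<in> carrier N; m' \<in> carrier M'; n' \<in> carrier N'\<rbrakk>
      \<Longrightarrow> \<phi> m n m' n' \<in> carrier P"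
  shows "tensor_lift K P (\<lambda>m n. tensor_lift K P (\<lambda>m' n'. \<phi> m n m' n') y) x =
    tensor_lift K P (\<lambda>m' n'. tensor_lift K P (\<lambda>m n. \<phi> m n m' n') x) y"
proof -
  interpret P: module K P by fact
  interpret Y: two_modules K M' N' by fact
  note f = rep_coeff[OF assms(3)] and g = Y.rep_coeff[OF assms(4)]
  let ?S = "{p. rep x p \<noteq> \<zero>\<^bsub>K\<^esub>}" and ?T = "{q. Y.rep y q \<noteq> \<zero>\<^bsub>K\<^esub>}"
  let ?\<phi> = "\<lambda>p q. \<phi> (fst p) (snd p) (fst q) (snd q)"
  have \<phi>: "?\<phi> p q \<in> carrier P" if "p \<in> ?S" "q \<in> ?T" for p q
    using closed f(2)[of p] g(2)[of q] that by (auto simp: mem_Times_iff)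
  have c: "rep x p \<odot>\<^bsub>P\<^esub> (Y.rep y q \<odot>\<^bsub>P\<^esub> ?\<phi> p q) \<in> carrier P" if "p \<in> ?S" "q \<in> ?T" for p q
    using \<phi>[OF that] f(1) g(1) by simp
  have comm: "Y.rep y q \<odot>\<^bsub>P\<^esub> (rep x p \<odot>\<^bsub>P\<^esub> ?\<phi> p q) = rep x p \<odot>\<^bsub>P\<^esub> (Y.rep y q \<odot>\<^bsub>P\<^esub> ?\<phi> p q)"
    if "p \<in> ?S" "q \<in> ?T" for p q
    using \<phi>[OF that] f(1) g(1) by (simp add: P.smult_assoc1[symmetric] M.m_comm)
  have "(\<Oplus>\<^bsub>P\<^esub>p\<in>?S. rep x p \<odot>\<^bsub>P\<^esub> (\<Oplus>\<^bsub>P\<^esub>q\<in>?T. Y.rep y q \<odot>\<^bsub>P\<^esub> ?\<phi> p q)) =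
      (\<Oplus>\<^bsub>P\<^esub>p\<in>?S. \<Oplus>\<^bsub>P\<^esub>q\<in>?T. rep x p \<odot>\<^bsub>P\<^esub> (Y.rep y q \<odot>\<^bsub>P\<^esub> ?\<phi> p q))"
    using f(1) g(1) \<phi> c g(3)
    by (intro P.finsum_cong' P.finsum_smult_ldistr) (auto intro!: P.finsum_closed)
  also have "\<dots> = (\<Oplus>\<^bsub>P\<^esub>q\<in>?T. \<Oplus>\<^bsub>P\<^esub>p\<in>?S. rep x p \<odot>\<^bsub>P\<^esub> (Y.rep y q \<odot>\<^bsub>P\<^esub> ?\<phi> p q))"
    using c f(3) g(3) by (intro finsum_swap P.abelian_monoid_axioms) auto
  also have "\<dots> = (\<Oplus>\<^bsub>P\<^esub>q\<in>?T. \<Oplus>\<^bsub>P\<^esub>p\<in>?S. Y.rep y q \<odot>\<^bsub>P\<^esub> (rep x p \<odot>\<^bsub>P\<^esub> ?\<phi> p q))"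
    using c comm by (intro P.finsum_cong') (auto intro!: P.finsum_closed)
  also have "\<dots> = (\<Oplus>\<^bsub>P\<^esub>q\<in>?T. Y.rep y q \<odot>\<^bsub>P\<^esub> (\<Oplus>\<^bsub>P\<^esub>p\<in>?S. rep x p \<odot>\<^bsub>P\<^esub> ?\<phi> p q))"
    using f(1) g(1) \<phi> c f(3)
    by (intro P.finsum_cong' P.finsum_smult_ldistr[symmetric]) (auto intro!: P.finsum_closed)
  finally show ?thesis
    unfolding tensor_lift_rep Y.tensor_lift_rep linear_extension_def .
qed

end

section \<open>Calculating in tensor products\<close>

text \<open>In Sweedler notation \<open>tensor_bind K M N P x \<phi>\<close> is \<open>\<Sum> \<phi> x\<^sub>1 x\<^sub>2\<close> for \<open>x = \<Sum> x\<^sub>1 \<otimes> x\<^sub>2\<close>.  The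
  modules are arguments and the guard is part of the definition so that the congruence rule, which
  lets the simplifier use \<open>x\<^sub>1 \<in> carrier M\<close> and \<open>x\<^sub>2 \<in> carrier N\<close> in \<open>\<phi>\<close>, has no side conditions.\<close>

definition tensor_bind ::
  "('k, 'r) ring_scheme \<Rightarrow> ('k, 'm) module \<Rightarrow> ('k, 'n) module \<Rightarrow> ('k, 'p) module \<Rightarrow>
    ('k, 'm, 'n) tensor \<Rightarrow> ('m \<Rightarrow> 'n \<Rightarrow> 'p) \<Rightarrow> 'p" where
  "tensor_bind K M N P x \<phi> =
    (if module K M \<and> module K N \<and> module K P \<and> x \<in> carrier (tensor K M N) \<and>
        (\<forall>m\<in>carrier M. \<forall>n\<in>carrier N. \<phi> m n \<in> carrier P)
     then tensor_lift K P \<phi> x else \<zero>\<^bsub>P\<^esub>)"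

lemma module_tensor [simp]: "\<lbrakk>module K M; module K N\<rbrakk> \<Longrightarrow> module K (tensor K M N)"
  by (intro two_modules.module_tensor two_modules.intro)

lemma pure_tensor_closed [simp]:
  "\<lbrakk>module K M; module K N; m \<in> carrier M; n \<in> carrier N\<rbrakk> \<Longrightarrow> pure_tensor K M N m n \<in> carrier (tensor K M N)"
  by (intro two_modules.pure_tensor_closed two_modules.intro)

lemma tensor_bind_cong [cong]:
  assumes "x = y" "\<And>m n. \<lbrakk>m \<in> carrier M; n \<in> carrier N\<rbrakk> \<Longrightarrow> \<phi> m n = \<psi> m n"
  shows "tensor_bind K M N P x \<phi> = tensor_bind K M N P y \<psi>"
  using assms two_modules.tensor_lift_cong[OF two_modules.intro, of K M N P \<phi> \<psi> y]
  by (auto simp: tensor_bind_def)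

lemma tensor_bind_closed [simp]: "module K P \<Longrightarrow> tensor_bind K M N P x \<phi> \<in> carrier P"
proof -
  assume "module K P"
  then interpret P: module K P .
  show ?thesis
    using two_modules.tensor_lift_closed[OF two_modules.intro, of K M N P \<phi> x]
    by (auto simp: tensor_bind_def)
qed

lemma tensor_lift_eq_bind:
  "\<lbrakk>module K M; module K N; module K P; x \<in> carrier (tensor K M N);
    \<And>m n. \<lbrakk>m \<in> carrier M; n \<in> carrier N\<rbrakk> \<Longrightarrow> \<phi> m n \<in> carrier P\<rbrakk>
   \<Longrightarrow> tensor_lift K P \<phi> x = tensor_bind K M N P x \<phi>"
  by (simp add: tensor_bind_def)

lemma module_hom_bind:
  assumes "g \<in> module_hom K P P'" "module K P" "module K P'"
    "\<And>m n. \<lbrakk>m \<in> carrier M; n \<in> carrier N\<rbrakk> \<Longrightarrow> \<phi> m n \<in> carrier P"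
  shows "g (tensor_bind K M N P x \<phi>) = tensor_bind K M N P' x (\<lambda>m n. g (\<phi> m n))"
  using assms module_hom_zero[OF assms(2,3,1)] module_homD(1)[OF assms(1)]
    two_modules.module_hom_tensor_lift[OF two_modules.intro, of K M N P P' g \<phi> x]
  by (auto simp: tensor_bind_def)

lemma tensor_bind_pure_id:
  assumes "module K M" "module K N" "x \<in> carrier (tensor K M N)"
  shows "tensor_bind K M N (tensor K M N) x (pure_tensor K M N) = x"
  using assms two_modules.tensor_lift_pure_tensor_id[OF two_modules.intro, of K M N x]
  by (auto simp: tensor_bind_def)

lemma tensor_bind_swap:
  assumes "module K P" "x \<in> carrier (tensor K M N)" "y \<in> carrier (tensor K M' N')"
    and closed: "\<And>m n m' n'. \<lbrakk>m \<in> carrier M; n \<in> carrier N; m' \<in> carrier M'; n' \<in> carrier N'\<rbrakk>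
      \<Longrightarrow> \<phi> m n m' n' \<in> carrier P"
    and "module K M" "module K N" "module K M'" "module K N'"
  shows "tensor_bind K M N P x (\<lambda>m n. tensor_bind K M' N' P y (\<lambda>m' n'. \<phi> m n m' n')) =
    tensor_bind K M' N' P y (\<lambda>m' n'. tensor_bind K M N P x (\<lambda>m n. \<phi> m n m' n'))"
proof -
  interpret X: two_modules K M N using assms by (intro two_modules.intro)
  interpret Y: two_modules K M' N' using assms by (intro two_modules.intro)
  have "tensor_bind K M N P x (\<lambda>m n. tensor_bind K M' N' P y (\<lambda>m' n'. \<phi> m n m' n')) =
      tensor_bind K M N P x (\<lambda>m n. tensor_lift K P (\<lambda>m' n'. \<phi> m n m' n') y)"
    using assms by (intro tensor_bind_cong) (simp_all add: tensor_bind_def)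
  also have "\<dots> = tensor_lift K P (\<lambda>m n. tensor_lift K P (\<lambda>m' n'. \<phi> m n m' n') y) x"
    using assms by (intro tensor_lift_eq_bind[symmetric] Y.tensor_lift_closed) simp_all
  also have "\<dots> = tensor_lift K P (\<lambda>m' n'. tensor_lift K P (\<lambda>m n. \<phi> m n m' n') x) y"
    using assms by (intro X.tensor_lift_swap[OF _ Y.two_modules_axioms]) simp_all
  also have "\<dots> = tensor_bind K M' N' P y (\<lambda>m' n'. tensor_lift K P (\<lambda>m n. \<phi> m n m' n') x)"
    using assms by (intro tensor_lift_eq_bind X.tensor_lift_closed) simp_all
  also have "\<dots> = tensor_bind K M' N' P y (\<lambda>m' n'. tensor_bind K M N P x (\<lambda>m n. \<phi> m n m' n'))"
    using assms by (intro tensor_bind_cong) (simp_all add: tensor_bind_def)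
  finally show ?thesis .
qed

lemma tensor_lift_pure:
  "\<lbrakk>module K M; module K N; module K P; bilinear K M N P \<phi>; m \<in> carrier M; n \<in> carrier N\<rbrakk>
   \<Longrightarrow> tensor_lift K P \<phi> (pure_tensor K M N m n) = \<phi> m n"
  by (intro two_modules.tensor_lift_pure_tensor two_modules.intro)

lemma tensor_bind_pure [simp]:
  assumes "module K M" "module K N" "module K P" "bilinear K M N P \<phi>" "m \<in> carrier M" "n \<in> carrier N"
  shows "tensor_bind K M N P (pure_tensor K M N m n) \<phi> = \<phi> m n"
  using tensor_lift_pure[OF assms] assms bilinearD(3)[OF assms(4)] by (auto simp: tensor_bind_def)

lemma tensor_lift_hom:
  "\<lbrakk>module K M; module K N; module K P; bilinear K M N P \<phi>\<rbrakk> \<Longrightarrow> tensor_lift K P \<phi> \<in> module_hom K (tensor K M N) P"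
  by (intro two_modules.tensor_lift_hom two_modules.intro)

lemma bilinear_iff [simp]:
  "bilinear K M N P (\<lambda>m n. \<phi> m n) \<longleftrightarrow>
    (\<forall>n\<in>carrier N. (\<lambda>m. \<phi> m n) \<in> module_hom K M P) \<and>
    (\<forall>m\<in>carrier M. (\<lambda>n. \<phi> m n) \<in> module_hom K N P)"
  by (simp add: bilinear_def)

lemma module_hom_id' [simp]: "(\<lambda>x. x) \<in> module_hom K M M" "id \<in> module_hom K M M"
  by (simp_all add: module_hom_id id_def)

lemma bind_hom1 [simp]:
  assumes "module K L" "module K M" "module K N" "module K P"
    "F \<in> module_hom K L (tensor K M N)" "bilinear K M N P \<phi>"
  shows "(\<lambda>l. tensor_bind K M N P (F l) \<phi>) \<in> module_hom K L P"
proof -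
  have "(\<lambda>l. tensor_bind K M N P (F l) \<phi>) \<in> module_hom K L P \<longleftrightarrow>
      (\<lambda>l. tensor_lift K P \<phi> (F l)) \<in> module_hom K L P"
    using assms(1-4) module_homD(1)[OF assms(5)] bilinearD(3)[OF assms(6)]
    by (intro module_hom_cong) (simp_all add: tensor_bind_def)
  then show ?thesis
    using module_hom_comp[OF tensor_lift_hom[OF assms(2-4,6)] assms(5)] by simp
qed

lemma bind_hom2 [simp]:
  assumes "module K L" "module K P"
    "\<And>m n. \<lbrakk>m \<in> carrier M; n \<in> carrier N\<rbrakk> \<Longrightarrow> (\<lambda>l. \<phi> l m n) \<in> module_hom K L P"
  shows "(\<lambda>l. tensor_bind K M N P x (\<phi> l)) \<in> module_hom K L P"
proof (cases "module K M \<and> module K N \<and> x \<in> carrier (tensor K M N)")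
  case True
  have "(\<lambda>l. tensor_bind K M N P x (\<phi> l)) \<in> module_hom K L P \<longleftrightarrow>
      (\<lambda>l. tensor_lift K P (\<phi> l) x) \<in> module_hom K L P"
    using True assms module_homD(1)[OF assms(3)] by (intro module_hom_cong) (simp_all add: tensor_bind_def)
  also have "\<dots>"
    using True assms by (intro two_modules.module_hom_tensor_lift_param[OF two_modules.intro]) auto
  finally show ?thesis .
next
  case False
  interpret P: module K P by fact
  have "tensor_bind K M N P x (\<phi> l) = \<zero>\<^bsub>P\<^esub>" for l using False by (auto simp: tensor_bind_def)
  then show ?thesis by (simp add: module_hom_def)
qed

lemma bilinear_pure_tensor: "\<lbrakk>module K M; module K N\<rbrakk> \<Longrightarrow> bilinear K M N (tensor K M N) (pure_tensor K M N)"
  by (intro two_modules.bilinear_pure_tensor two_modules.intro)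

lemma bilinear_hom:
  assumes "bilinear K M N P \<phi>"
  shows "\<lbrakk>F \<in> module_hom K L M; n \<in> carrier N\<rbrakk> \<Longrightarrow> (\<lambda>l. \<phi> (F l) n) \<in> module_hom K L P"
    and "\<lbrakk>G \<in> module_hom K L' N; m \<in> carrier M\<rbrakk> \<Longrightarrow> (\<lambda>l. \<phi> m (G l)) \<in> module_hom K L' P"
    and "m \<in> carrier M \<Longrightarrow> \<phi> m \<in> module_hom K N P"
  using bilinearD[OF assms] module_hom_comp[of "\<lambda>m. \<phi> m n" K M P F L]
    module_hom_comp[of "\<phi> m" K N P G L']
  by simp_all

lemmas pure_hom [simp] = bilinear_hom[OF bilinear_pure_tensor]

lemma tensor_map_bilinear:
  assumes "module K M" "module K N" "module K M'" "module K N'" "f \<in> module_hom K M M'" "g \<in> module_hom K N N'"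
  shows "bilinear K M N (tensor K M' N') (\<lambda>m n. pure_tensor K M' N' (f m) (g n))"
  using assms module_homD(1)[OF assms(5)] module_homD(1)[OF assms(6)] by simp

lemma tensor_map_hom [simp]:
  "\<lbrakk>module K M; module K N; module K M'; module K N'; f \<in> module_hom K M M'; g \<in> module_hom K N N'\<rbrakk>
   \<Longrightarrow> tensor_map K M' N' f g \<in> module_hom K (tensor K M N) (tensor K M' N')"
  unfolding tensor_map_def by (intro tensor_lift_hom tensor_map_bilinear module_tensor)

lemma tensor_map_pure:
  "\<lbrakk>module K M; module K N; module K M'; module K N'; f \<in> module_hom K M M'; g \<in> module_hom K N N';
    m \<in> carrier M; n \<in> carrier N\<rbrakk>
   \<Longrightarrow> tensor_map K M' N' f g (pure_tensor K M N m n) = pure_tensor K M' N' (f m) (g n)"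
  unfolding tensor_map_def by (intro tensor_lift_pure tensor_map_bilinear module_tensor)

lemma bilinear_cong:
  assumes "module K M" "module K N" "\<And>m n. \<lbrakk>m \<in> carrier M; n \<in> carrier N\<rbrakk> \<Longrightarrow> \<phi> m n = \<psi> m n"
    and "bilinear K M N P \<psi>"
  shows "bilinear K M N P \<phi>"
  using assms module_hom_cong[of M "\<lambda>m. \<phi> m n" "\<lambda>m. \<psi> m n" K P for n]
    module_hom_cong[of N "\<phi> m" "\<psi> m" K P for m]
  unfolding bilinear_def by simp

lemma tensor_assoc_bilinear:
  assumes "module K M" "module K N" "module K P"
  shows "bilinear K (tensor K M N) P (tensor K M (tensor K N P)) (\<lambda>u p.
    tensor_lift K (tensor K M (tensor K N P))
      (\<lambda>m n. pure_tensor K M (tensor K N P) m (pure_tensor K N P n p)) u)"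
  by (rule bilinear_cong[where \<psi> = "\<lambda>u p. tensor_bind K M N (tensor K M (tensor K N P)) u
      (\<lambda>m n. pure_tensor K M (tensor K N P) m (pure_tensor K N P n p))"])
    (use assms in \<open>simp_all add: tensor_lift_eq_bind\<close>)

lemma tensor_assoc_hom [simp]:
  "\<lbrakk>module K M; module K N; module K P\<rbrakk>
   \<Longrightarrow> tensor_assoc K M N P \<in> module_hom K (tensor K (tensor K M N) P) (tensor K M (tensor K N P))"
  unfolding tensor_assoc_def Let_def by (intro tensor_lift_hom tensor_assoc_bilinear module_tensor)

lemma tensor_assoc_pure:
  assumes "module K M" "module K N" "module K P" "u \<in> carrier (tensor K M N)" "p \<in> carrier P"
  shows "tensor_assoc K M N P (pure_tensor K (tensor K M N) P u p) =
    tensor_bind K M N (tensor K M (tensor K N P)) u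
      (\<lambda>m n. pure_tensor K M (tensor K N P) m (pure_tensor K N P n p))"
  unfolding tensor_assoc_def Let_def using assms
  by (simp add: tensor_lift_pure[OF _ _ _ tensor_assoc_bilinear] tensor_lift_eq_bind del: bilinear_iff)

lemma tensor_assoc_inv_bilinear:
  assumes "module K M" "module K N" "module K P"
  shows "bilinear K M (tensor K N P) (tensor K (tensor K M N) P) (\<lambda>m v.
    tensor_lift K (tensor K (tensor K M N) P)
      (\<lambda>n p. pure_tensor K (tensor K M N) P (pure_tensor K M N m n) p) v)"
  by (rule bilinear_cong[where \<psi> = "\<lambda>m v. tensor_bind K N P (tensor K (tensor K M N) P) v
      (\<lambda>n p. pure_tensor K (tensor K M N) P (pure_tensor K M N m n) p)"])
    (use assms in \<open>simp_all add: tensor_lift_eq_bind\<close>)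

lemma tensor_assoc_inv_hom [simp]:
  "\<lbrakk>module K M; module K N; module K P\<rbrakk>
   \<Longrightarrow> tensor_assoc_inv K M N P \<in> module_hom K (tensor K M (tensor K N P)) (tensor K (tensor K M N) P)"
  unfolding tensor_assoc_inv_def Let_def by (intro tensor_lift_hom tensor_assoc_inv_bilinear module_tensor)

lemma tensor_assoc_inv_pure:
  assumes "module K M" "module K N" "module K P" "m \<in> carrier M" "v \<in> carrier (tensor K N P)"
  shows "tensor_assoc_inv K M N P (pure_tensor K M (tensor K N P) m v) =
    tensor_bind K N P (tensor K (tensor K M N) P) v
      (\<lambda>n p. pure_tensor K (tensor K M N) P (pure_tensor K M N m n) p)"
  unfolding tensor_assoc_inv_def Let_def using assms
  by (simp add: tensor_lift_pure[OF _ _ _ tensor_assoc_inv_bilinear] tensor_lift_eq_bind del: bilinear_iff)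

lemma module_hom_eq_on_pure:
  assumes "module K M" "module K N" "module K P" "f \<in> module_hom K (tensor K M N) P" "g \<in> module_hom K (tensor K M N) P"
  shows "(\<forall>x\<in>carrier (tensor K M N). f x = g x) \<longleftrightarrow>
    (\<forall>m\<in>carrier M. \<forall>n\<in>carrier N. f (pure_tensor K M N m n) = g (pure_tensor K M N m n))"
proof
  assume eq: "\<forall>m\<in>carrier M. \<forall>n\<in>carrier N. f (pure_tensor K M N m n) = g (pure_tensor K M N m n)"
  show "\<forall>x\<in>carrier (tensor K M N). f x = g x"
  proof
    fix x assume x: "x \<in> carrier (tensor K M N)"
    have "h x = tensor_bind K M N P x (\<lambda>m n. h (pure_tensor K M N m n))"
      if "h \<in> module_hom K (tensor K M N) P" for h
      using module_hom_bind[OF that, of M N "pure_tensor K M N" x] assms x by (simp add: tensor_bind_pure_id)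
    from this[OF assms(4)] this[OF assms(5)] show "f x = g x" using eq by simp
  qed
qed (use assms in simp)

lemma mult_map_hom [simp]:
  "\<lbrakk>module K A; bilinear K A A A (mult A)\<rbrakk> \<Longrightarrow> mult_map K A \<in> module_hom K (tensor K A A) A"
  unfolding mult_map_def by (rule tensor_lift_hom)

lemma mult_map_pure [simp]:
  "\<lbrakk>module K A; bilinear K A A A (mult A); x \<in> carrier A; y \<in> carrier A\<rbrakk>
   \<Longrightarrow> mult_map K A (pure_tensor K A A x y) = x \<otimes>\<^bsub>A\<^esub> y"
  unfolding mult_map_def by (rule tensor_lift_pure)

lemma tensor_map_bind:
  "\<lbrakk>module K M; module K N; module K M'; module K N'; f \<in> module_hom K M M'; g \<in> module_hom K N N';
    \<And>m n. \<lbrakk>m \<in> carrier L; n \<in> carrier L'\<rbrakk> \<Longrightarrow> \<phi> m n \<in> carrier (tensor K M N)\<rbrakk>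
   \<Longrightarrow> tensor_map K M' N' f g (tensor_bind K L L' (tensor K M N) x \<phi>) =
     tensor_bind K L L' (tensor K M' N') x (\<lambda>m n. tensor_map K M' N' f g (\<phi> m n))"
  by (intro module_hom_bind tensor_map_hom module_tensor)

lemma tensor_assoc_bind:
  "\<lbrakk>module K M; module K N; module K P;
    \<And>m n. \<lbrakk>m \<in> carrier L; n \<in> carrier L'\<rbrakk> \<Longrightarrow> \<phi> m n \<in> carrier (tensor K (tensor K M N) P)\<rbrakk>
   \<Longrightarrow> tensor_assoc K M N P (tensor_bind K L L' (tensor K (tensor K M N) P) x \<phi>) =
     tensor_bind K L L' (tensor K M (tensor K N P)) x (\<lambda>m n. tensor_assoc K M N P (\<phi> m n))"
  by (intro module_hom_bind tensor_assoc_hom module_tensor)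

lemma tensor_assoc_inv_bind:
  "\<lbrakk>module K M; module K N; module K P;
    \<And>m n. \<lbrakk>m \<in> carrier L; n \<in> carrier L'\<rbrakk> \<Longrightarrow> \<phi> m n \<in> carrier (tensor K M (tensor K N P))\<rbrakk>
   \<Longrightarrow> tensor_assoc_inv K M N P (tensor_bind K L L' (tensor K M (tensor K N P)) x \<phi>) =
     tensor_bind K L L' (tensor K (tensor K M N) P) x (\<lambda>m n. tensor_assoc_inv K M N P (\<phi> m n))"
  by (intro module_hom_bind tensor_assoc_inv_hom module_tensor)

lemma pure_tensor_bind_left:
  "\<lbrakk>module K M; module K N; n \<in> carrier N;
    \<And>i j. \<lbrakk>i \<in> carrier L; j \<in> carrier L'\<rbrakk> \<Longrightarrow> \<phi> i j \<in> carrier M\<rbrakk>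
   \<Longrightarrow> pure_tensor K M N (tensor_bind K L L' M x \<phi>) n =
     tensor_bind K L L' (tensor K M N) x (\<lambda>i j. pure_tensor K M N (\<phi> i j) n)"
  by (rule module_hom_bind[where g = "\<lambda>m. pure_tensor K M N m n"]) simp_all

lemma pure_tensor_bind_right:
  "\<lbrakk>module K M; module K N; m \<in> carrier M;
    \<And>i j. \<lbrakk>i \<in> carrier L; j \<in> carrier L'\<rbrakk> \<Longrightarrow> \<phi> i j \<in> carrier N\<rbrakk>
   \<Longrightarrow> pure_tensor K M N m (tensor_bind K L L' N x \<phi>) =
     tensor_bind K L L' (tensor K M N) x (\<lambda>i j. pure_tensor K M N m (\<phi> i j))"
  by (rule module_hom_bind[where g = "pure_tensor K M N m"]) simp_all

lemma tensor_bind_bind: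
  "\<lbrakk>module K M; module K N; module K P; bilinear K M N P \<psi>;
    \<And>i j. \<lbrakk>i \<in> carrier L; j \<in> carrier L'\<rbrakk> \<Longrightarrow> \<phi> i j \<in> carrier (tensor K M N)\<rbrakk>
   \<Longrightarrow> tensor_bind K M N P (tensor_bind K L L' (tensor K M N) x \<phi>) \<psi> =
     tensor_bind K L L' P x (\<lambda>i j. tensor_bind K M N P (\<phi> i j) \<psi>)"
  by (rule module_hom_bind[where g = "\<lambda>u. tensor_bind K M N P u \<psi>"])
    (simp_all del: bilinear_iff)

lemmas tensor_eval = tensor_map_pure tensor_assoc_pure tensor_assoc_inv_pure
  tensor_map_bind tensor_assoc_bind tensor_assoc_inv_bind
  pure_tensor_bind_left pure_tensor_bind_right tensor_bind_bind tensor_bind_pure_id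

lemma module_hom_o:
  "\<lbrakk>g \<in> module_hom K N P; f \<in> module_hom K M N\<rbrakk> \<Longrightarrow> g \<circ> f \<in> module_hom K M P"
  by (simp add: comp_def module_hom_comp)

lemma module_hom_pure_right:
  "\<lbrakk>module K M; module K N; f \<in> module_hom K (tensor K M N) P; m \<in> carrier M\<rbrakk>
   \<Longrightarrow> (\<lambda>n. f (pure_tensor K M N m n)) \<in> module_hom K N P"
  by (rule module_hom_comp[of f K "tensor K M N"]) simp_all

lemma module_hom_pure_left:
  "\<lbrakk>module K M; module K N; f \<in> module_hom K (tensor K M N) P; n \<in> carrier N\<rbrakk>
   \<Longrightarrow> (\<lambda>m. f (pure_tensor K M N m n)) \<in> module_hom K M P"
  by (rule module_hom_comp[of f K "tensor K M N"]) simp_all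

lemma module_hom_eq_on_pure_right:
  assumes "module K L" "module K M" "module K N" "module K P"
    and f: "f \<in> module_hom K (tensor K L (tensor K M N)) P" and g: "g \<in> module_hom K (tensor K L (tensor K M N)) P"
  shows "(\<forall>x\<in>carrier (tensor K L (tensor K M N)). f x = g x) \<longleftrightarrow>
    (\<forall>l\<in>carrier L. \<forall>m\<in>carrier M. \<forall>n\<in>carrier N.
      f (pure_tensor K L (tensor K M N) l (pure_tensor K M N m n)) =
      g (pure_tensor K L (tensor K M N) l (pure_tensor K M N m n)))"
  unfolding module_hom_eq_on_pure[OF assms(1) module_tensor[OF assms(2,3)] assms(4) f g]
  using module_hom_eq_on_pure[OF assms(2-4) module_hom_pure_right[OF assms(1) module_tensor[OF assms(2,3)] f]
      module_hom_pure_right[OF assms(1) module_tensor[OF assms(2,3)] g]]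
  by simp

lemma module_hom_eq_on_pure_left:
  assumes "module K L" "module K M" "module K N" "module K P"
    and f: "f \<in> module_hom K (tensor K (tensor K L M) N) P" and g: "g \<in> module_hom K (tensor K (tensor K L M) N) P"
  shows "(\<forall>x\<in>carrier (tensor K (tensor K L M) N). f x = g x) \<longleftrightarrow>
    (\<forall>l\<in>carrier L. \<forall>m\<in>carrier M. \<forall>n\<in>carrier N.
      f (pure_tensor K (tensor K L M) N (pure_tensor K L M l m) n) =
      g (pure_tensor K (tensor K L M) N (pure_tensor K L M l m) n))"
proof -
  have "(\<forall>x\<in>carrier (tensor K (tensor K L M) N). f x = g x) \<longleftrightarrow>
      (\<forall>n\<in>carrier N. \<forall>u\<in>carrier (tensor K L M). f (pure_tensor K (tensor K L M) N u n) = g (pure_tensor K (tensor K L M) N u n))"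
    unfolding module_hom_eq_on_pure[OF module_tensor[OF assms(1,2)] assms(3,4) f g] by blast
  also have "\<dots> \<longleftrightarrow> (\<forall>n\<in>carrier N. \<forall>l\<in>carrier L. \<forall>m\<in>carrier M.
      f (pure_tensor K (tensor K L M) N (pure_tensor K L M l m) n) =
      g (pure_tensor K (tensor K L M) N (pure_tensor K L M l m) n))"
    using module_hom_eq_on_pure[OF assms(1,2,4) module_hom_pure_left[OF module_tensor[OF assms(1,2)] assms(3) f]
        module_hom_pure_left[OF module_tensor[OF assms(1,2)] assms(3) g]]
    by simp
  finally show ?thesis by blast
qed

lemma tensor_bind_pure_right_id:
  "\<lbrakk>module K M; module K N; module K P; m \<in> carrier M; v \<in> carrier (tensor K N P)\<rbrakk>
   \<Longrightarrow> tensor_bind K N P (tensor K M (tensor K N P)) v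
        (\<lambda>n p. pure_tensor K M (tensor K N P) m (pure_tensor K N P n p)) =
      pure_tensor K M (tensor K N P) m v"
  using pure_tensor_bind_right[of K M "tensor K N P" m N P "pure_tensor K N P" v]
  by (simp add: tensor_bind_pure_id)

lemma bilinear_eq_on_pure:
  assumes "module K M" "module K N" "module K M'" "module K N'" "module K P"
    and F: "bilinear K (tensor K M N) (tensor K M' N') P F" and G: "bilinear K (tensor K M N) (tensor K M' N') P G"
  shows "(\<forall>u\<in>carrier (tensor K M N). \<forall>v\<in>carrier (tensor K M' N'). F u v = G u v) \<longleftrightarrow>
    (\<forall>m\<in>carrier M. \<forall>n\<in>carrier N. \<forall>m'\<in>carrier M'. \<forall>n'\<in>carrier N'.
      F (pure_tensor K M N m n) (pure_tensor K M' N' m' n') = G (pure_tensor K M N m n) (pure_tensor K M' N' m' n'))"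
proof -
  have "(\<forall>u\<in>carrier (tensor K M N). \<forall>v\<in>carrier (tensor K M' N'). F u v = G u v) \<longleftrightarrow>
     (\<forall>v\<in>carrier (tensor K M' N'). \<forall>u\<in>carrier (tensor K M N). F u v = G u v)" by blast
  also have "\<dots> \<longleftrightarrow> (\<forall>v\<in>carrier (tensor K M' N'). \<forall>m\<in>carrier M. \<forall>n\<in>carrier N.
      F (pure_tensor K M N m n) v = G (pure_tensor K M N m n) v)"
    using module_hom_eq_on_pure[OF assms(1,2,5) bilinearD(1)[OF F] bilinearD(1)[OF G]] by simp
  also have "\<dots> \<longleftrightarrow> (\<forall>m\<in>carrier M. \<forall>n\<in>carrier N. \<forall>v\<in>carrier (tensor K M' N').
      F (pure_tensor K M N m n) v = G (pure_tensor K M N m n) v)" by blast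
  also have "\<dots> \<longleftrightarrow> (\<forall>m\<in>carrier M. \<forall>n\<in>carrier N. \<forall>m'\<in>carrier M'. \<forall>n'\<in>carrier N'.
      F (pure_tensor K M N m n) (pure_tensor K M' N' m' n') = G (pure_tensor K M N m n) (pure_tensor K M' N' m' n'))"
    using module_hom_eq_on_pure[OF assms(3-5) bilinearD(2)[OF F] bilinearD(2)[OF G]] assms by simp
  finally show ?thesis .
qed

lemma tensor_assoc_bij:
  assumes "module K M" "module K N" "module K P"
  shows "bij_betw (tensor_assoc K M N P) (carrier (tensor K (tensor K M N) P)) (carrier (tensor K M (tensor K N P)))"
proof (rule bij_betw_byWitness[where f' = "tensor_assoc_inv K M N P"])
  have "\<forall>x\<in>carrier (tensor K (tensor K M N) P). (tensor_assoc_inv K M N P \<circ> tensor_assoc K M N P) x = id x"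
    using assms
    by (subst module_hom_eq_on_pure_left[where P = "tensor K (tensor K M N) P"])
      (auto simp: tensor_eval intro!: module_hom_o tensor_assoc_hom tensor_assoc_inv_hom)
  then show "\<forall>x\<in>carrier (tensor K (tensor K M N) P). tensor_assoc_inv K M N P (tensor_assoc K M N P x) = x"
    by simp
  have "\<forall>x\<in>carrier (tensor K M (tensor K N P)). (tensor_assoc K M N P \<circ> tensor_assoc_inv K M N P) x = id x"
    using assms
    by (subst module_hom_eq_on_pure_right[where P = "tensor K M (tensor K N P)"])
      (auto simp: tensor_eval intro!: module_hom_o tensor_assoc_hom tensor_assoc_inv_hom)
  then show "\<forall>x\<in>carrier (tensor K M (tensor K N P)). tensor_assoc K M N P (tensor_assoc_inv K M N P x) = x"
    by simp
qed (use assms in \<open>auto intro!: module_homD(1)[OF tensor_assoc_hom] module_homD(1)[OF tensor_assoc_inv_hom]\<close>)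

section \<open>Twisting maps and twisted tensor products\<close>

lemma twisted_tensor_simps [simp]:
  "carrier (twisted_tensor K A B R) = carrier (tensor K A B)"
  "add (twisted_tensor K A B R) = add (tensor K A B)"
  "zero (twisted_tensor K A B R) = zero (tensor K A B)"
  "smult (twisted_tensor K A B R) = smult (tensor K A B)"
  "one (twisted_tensor K A B R) = pure_tensor K A B \<one>\<^bsub>A\<^esub> \<one>\<^bsub>B\<^esub>"
  by (simp_all add: twisted_tensor_def)

lemma module_twisted_tensor [simp]: "module K (twisted_tensor K A B R) \<longleftrightarrow> module K (tensor K A B)"
  by (simp add: module_def module_axioms_def abelian_group_def abelian_monoid_def abelian_group_axioms_def)

lemma module_hom_twisted_tensor [simp]:
  "module_hom K (twisted_tensor K A B R) N = module_hom K (tensor K A B) N"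
  "module_hom K M (twisted_tensor K A B R) = module_hom K M (tensor K A B)"
  by (simp_all add: module_hom_def)

lemma tensor_twisted_tensor [simp]:
  "tensor K (twisted_tensor K A B R) N = tensor K (tensor K A B) N"
  "tensor K M (twisted_tensor K A B R) = tensor K M (tensor K A B)"
  by (simp_all add: tensor_def tensor_relations_def bilinear_relations_def)

lemma pure_tensor_twisted_tensor [simp]:
  "pure_tensor K (twisted_tensor K A B R) N = pure_tensor K (tensor K A B) N"
  "pure_tensor K M (twisted_tensor K A B R) = pure_tensor K M (tensor K A B)"
  by (simp_all add: fun_eq_iff pure_tensor_def tensor_relations_def bilinear_relations_def)

lemma tensor_bind_twisted_tensor:
  "tensor_bind K (twisted_tensor K A B R) N = tensor_bind K (tensor K A B) N"
  "tensor_bind K M (twisted_tensor K A B R) = tensor_bind K M (tensor K A B)"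
  by (simp_all add: tensor_bind_def fun_eq_iff)

lemma bilinear_twisted_tensor:
  "bilinear K (twisted_tensor K A B R) (twisted_tensor K A B R) (twisted_tensor K A B R) =
    bilinear K (tensor K A B) (tensor K A B) (tensor K A B)"
  by (simp add: fun_eq_iff)

locale twist_data =
  fixes K :: "('k, 'r) ring_scheme" and A :: "('k, 'a) module" and B :: "('k, 'b) module"
    and R :: "('k, 'b, 'a) tensor \<Rightarrow> ('k, 'a, 'b) tensor"
  assumes module_A [simp]: "module K A" and module_B [simp]: "module K B"
    and mult_A: "bilinear K A A A (mult A)" and mult_B: "bilinear K B B B (mult B)"
    and R_hom [simp]: "R \<in> module_hom K (tensor K B A) (tensor K A B)"
begin

lemmas mult_hom [simp] = bilinear_hom[OF mult_A] bilinear_hom[OF mult_B]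
lemmas mult_closed [simp] = bilinearD(3)[OF mult_A] bilinearD(3)[OF mult_B]
lemmas R_closed [simp] = module_homD(1)[OF R_hom]
lemmas R_comp [simp] = module_hom_comp[OF R_hom]
lemmas R_bind [simp] = module_hom_bind[OF R_hom module_tensor[OF module_B module_A] module_tensor[OF module_A module_B]]

lemma twisting_map_iff:
  "twisting_map K A B R \<longleftrightarrow>
    (\<forall>b\<in>carrier B. \<forall>a\<in>carrier A. \<forall>a'\<in>carrier A.
      R (pure_tensor K B A b (a \<otimes>\<^bsub>A\<^esub> a')) =
      tensor_bind K A B (tensor K A B) (R (pure_tensor K B A b a)) (\<lambda>x y.
        tensor_bind K A B (tensor K A B) (R (pure_tensor K B A y a')) (\<lambda>x' y'.
          pure_tensor K A B (x \<otimes>\<^bsub>A\<^esub> x') y'))) \<and>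
    (\<forall>b\<in>carrier B. \<forall>b'\<in>carrier B. \<forall>a\<in>carrier A.
      R (pure_tensor K B A (b \<otimes>\<^bsub>B\<^esub> b') a) =
      tensor_bind K A B (tensor K A B) (R (pure_tensor K B A b' a)) (\<lambda>x y.
        tensor_bind K A B (tensor K A B) (R (pure_tensor K B A b x)) (\<lambda>x' y'.
          pure_tensor K A B x' (y' \<otimes>\<^bsub>B\<^esub> y))))"
proof -
  have left: "(\<forall>x\<in>carrier (tensor K B (tensor K A A)).
      (R \<circ> tensor_map K B A id (mult_map K A)) x =
      (tensor_map K A B (mult_map K A) id \<circ> tensor_assoc_inv K A A B \<circ>
       tensor_map K A (tensor K A B) id R \<circ> tensor_assoc K A B A \<circ>
       tensor_map K (tensor K A B) A R id \<circ> tensor_assoc_inv K B A A) x) \<longleftrightarrow>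
    (\<forall>b\<in>carrier B. \<forall>a\<in>carrier A. \<forall>a'\<in>carrier A.
      R (pure_tensor K B A b (a \<otimes>\<^bsub>A\<^esub> a')) =
      tensor_bind K A B (tensor K A B) (R (pure_tensor K B A b a)) (\<lambda>x y.
        tensor_bind K A B (tensor K A B) (R (pure_tensor K B A y a')) (\<lambda>x' y'.
          pure_tensor K A B (x \<otimes>\<^bsub>A\<^esub> x') y')))"
    by (subst module_hom_eq_on_pure_right[where P = "tensor K A B"])
      (auto simp: tensor_eval intro!: module_hom_o tensor_map_hom tensor_assoc_hom tensor_assoc_inv_hom mult_map_hom mult_A mult_B)
  have right: "(\<forall>x\<in>carrier (tensor K (tensor K B B) A).
      (R \<circ> tensor_map K B A (mult_map K B) id) x =
      (tensor_map K A B id (mult_map K B) \<circ> tensor_assoc K A B B \<circ>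
       tensor_map K (tensor K A B) B R id \<circ> tensor_assoc_inv K B A B \<circ>
       tensor_map K B (tensor K A B) id R \<circ> tensor_assoc K B B A) x) \<longleftrightarrow>
    (\<forall>b\<in>carrier B. \<forall>b'\<in>carrier B. \<forall>a\<in>carrier A.
      R (pure_tensor K B A (b \<otimes>\<^bsub>B\<^esub> b') a) =
      tensor_bind K A B (tensor K A B) (R (pure_tensor K B A b' a)) (\<lambda>x y.
        tensor_bind K A B (tensor K A B) (R (pure_tensor K B A b x)) (\<lambda>x' y'.
          pure_tensor K A B x' (y' \<otimes>\<^bsub>B\<^esub> y))))"
    by (subst module_hom_eq_on_pure_left[where P = "tensor K A B"])
      (auto simp: tensor_eval intro!: module_hom_o tensor_map_hom tensor_assoc_hom tensor_assoc_inv_hom mult_map_hom mult_A mult_B)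
  show ?thesis
    unfolding twisting_map_def left right using R_hom by simp
qed

lemma twisted_mult_map_pure:
  assumes "x \<in> carrier (tensor K A B)" "y \<in> carrier (tensor K A B)"
  shows "twisted_mult_map K A B R (pure_tensor K (tensor K A B) (tensor K A B) x y) =
    tensor_bind K A B (tensor K A B) x (\<lambda>a b. tensor_bind K A B (tensor K A B) y (\<lambda>a' b'.
      tensor_bind K A B (tensor K A B) (R (pure_tensor K B A b a')) (\<lambda>s t.
        pure_tensor K A B (a \<otimes>\<^bsub>A\<^esub> s) (t \<otimes>\<^bsub>B\<^esub> b'))))"
  using assms by (simp add: tensor_eval twisted_mult_map_def)

lemma twisted_tensor_mult:
  assumes "x \<in> carrier (tensor K A B)" "y \<in> carrier (tensor K A B)"
  shows "x \<otimes>\<^bsub>twisted_tensor K A B R\<^esub> y =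
    tensor_bind K A B (tensor K A B) x (\<lambda>a b. tensor_bind K A B (tensor K A B) y (\<lambda>a' b'.
      tensor_bind K A B (tensor K A B) (R (pure_tensor K B A b a')) (\<lambda>s t.
        pure_tensor K A B (a \<otimes>\<^bsub>A\<^esub> s) (t \<otimes>\<^bsub>B\<^esub> b'))))"
  using twisted_mult_map_pure[OF assms] by (simp add: twisted_tensor_def)

lemma bilinear_twisted_tensor_mult:
  "bilinear K (tensor K A B) (tensor K A B) (tensor K A B) (mult (twisted_tensor K A B R))"
  by (rule bilinear_cong[OF _ _ twisted_tensor_mult]) simp_all

end

section \<open>Twisted tensor products of three algebras\<close>

locale twist_triple =
  R1: twist_data K A B R1 + R2: twist_data K B C R2 + R3: twist_data K A C R3
  for K :: "('k, 'r) ring_scheme" and A :: "('k, 'a) module" and B :: "('k, 'b) module" and C :: "('k, 'c) module"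
    and R1 R2 R3 +
  assumes R1_left [simp]: "\<lbrakk>b \<in> carrier B; a \<in> carrier A; a' \<in> carrier A\<rbrakk> \<Longrightarrow>
      R1 (pure_tensor K B A b (a \<otimes>\<^bsub>A\<^esub> a')) =
      tensor_bind K A B (tensor K A B) (R1 (pure_tensor K B A b a)) (\<lambda>x y.
        tensor_bind K A B (tensor K A B) (R1 (pure_tensor K B A y a')) (\<lambda>x' y'.
          pure_tensor K A B (x \<otimes>\<^bsub>A\<^esub> x') y'))"
    and R1_right [simp]: "\<lbrakk>b \<in> carrier B; b' \<in> carrier B; a \<in> carrier A\<rbrakk> \<Longrightarrow>
      R1 (pure_tensor K B A (b \<otimes>\<^bsub>B\<^esub> b') a) =
      tensor_bind K A B (tensor K A B) (R1 (pure_tensor K B A b' a)) (\<lambda>x y.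
        tensor_bind K A B (tensor K A B) (R1 (pure_tensor K B A b x)) (\<lambda>x' y'.
          pure_tensor K A B x' (y' \<otimes>\<^bsub>B\<^esub> y)))"
    and R2_left [simp]: "\<lbrakk>c \<in> carrier C; b \<in> carrier B; b' \<in> carrier B\<rbrakk> \<Longrightarrow>
      R2 (pure_tensor K C B c (b \<otimes>\<^bsub>B\<^esub> b')) =
      tensor_bind K B C (tensor K B C) (R2 (pure_tensor K C B c b)) (\<lambda>x y.
        tensor_bind K B C (tensor K B C) (R2 (pure_tensor K C B y b')) (\<lambda>x' y'.
          pure_tensor K B C (x \<otimes>\<^bsub>B\<^esub> x') y'))"
    and R2_right [simp]: "\<lbrakk>c \<in> carrier C; c' \<in> carrier C; b \<in> carrier B\<rbrakk> \<Longrightarrow>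
      R2 (pure_tensor K C B (c \<otimes>\<^bsub>C\<^esub> c') b) =
      tensor_bind K B C (tensor K B C) (R2 (pure_tensor K C B c' b)) (\<lambda>x y.
        tensor_bind K B C (tensor K B C) (R2 (pure_tensor K C B c x)) (\<lambda>x' y'.
          pure_tensor K B C x' (y' \<otimes>\<^bsub>C\<^esub> y)))"
    and R3_left [simp]: "\<lbrakk>c \<in> carrier C; a \<in> carrier A; a' \<in> carrier A\<rbrakk> \<Longrightarrow>
      R3 (pure_tensor K C A c (a \<otimes>\<^bsub>A\<^esub> a')) =
      tensor_bind K A C (tensor K A C) (R3 (pure_tensor K C A c a)) (\<lambda>x y.
        tensor_bind K A C (tensor K A C) (R3 (pure_tensor K C A y a')) (\<lambda>x' y'.
          pure_tensor K A C (x \<otimes>\<^bsub>A\<^esub> x') y'))"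
    and R3_right [simp]: "\<lbrakk>c \<in> carrier C; c' \<in> carrier C; a \<in> carrier A\<rbrakk> \<Longrightarrow>
      R3 (pure_tensor K C A (c \<otimes>\<^bsub>C\<^esub> c') a) =
      tensor_bind K A C (tensor K A C) (R3 (pure_tensor K C A c' a)) (\<lambda>x y.
        tensor_bind K A C (tensor K A C) (R3 (pure_tensor K C A c x)) (\<lambda>x' y'.
          pure_tensor K A C x' (y' \<otimes>\<^bsub>C\<^esub> y)))"
    and one_closed [simp]: "\<one>\<^bsub>A\<^esub> \<in> carrier A" "\<one>\<^bsub>B\<^esub> \<in> carrier B" "\<one>\<^bsub>C\<^esub> \<in> carrier C"
    and one_mult_A [simp]: "a \<in> carrier A \<Longrightarrow> \<one>\<^bsub>A\<^esub> \<otimes>\<^bsub>A\<^esub> a = a"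
    and one_mult_B [simp]: "b \<in> carrier B \<Longrightarrow> \<one>\<^bsub>B\<^esub> \<otimes>\<^bsub>B\<^esub> b = b" "b \<in> carrier B \<Longrightarrow> b \<otimes>\<^bsub>B\<^esub> \<one>\<^bsub>B\<^esub> = b"
    and mult_one_C [simp]: "c \<in> carrier C \<Longrightarrow> c \<otimes>\<^bsub>C\<^esub> \<one>\<^bsub>C\<^esub> = c"
    and R1_one [simp]: "a \<in> carrier A \<Longrightarrow> R1 (pure_tensor K B A \<one>\<^bsub>B\<^esub> a) = pure_tensor K A B a \<one>\<^bsub>B\<^esub>"
    and R2_one [simp]: "c \<in> carrier C \<Longrightarrow> R2 (pure_tensor K C B c \<one>\<^bsub>B\<^esub>) = pure_tensor K B C \<one>\<^bsub>B\<^esub> c"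
    and R3_one [simp]: "a \<in> carrier A \<Longrightarrow> R3 (pure_tensor K C A \<one>\<^bsub>C\<^esub> a) = pure_tensor K A C a \<one>\<^bsub>C\<^esub>"
      "c \<in> carrier C \<Longrightarrow> R3 (pure_tensor K C A c \<one>\<^bsub>A\<^esub>) = pure_tensor K A C \<one>\<^bsub>A\<^esub> c"
begin

abbreviation "AB \<equiv> tensor K A B"
abbreviation "BC \<equiv> tensor K B C"
abbreviation "r1 b a \<equiv> R1 (pure_tensor K B A b a)"
abbreviation "r2 c b \<equiv> R2 (pure_tensor K C B c b)"
abbreviation "r3 c a \<equiv> R3 (pure_tensor K C A c a)"
abbreviation "bR1 P b a \<phi> \<equiv> tensor_bind K A B P (r1 b a) \<phi>"
abbreviation "bR2 P c b \<phi> \<equiv> tensor_bind K B C P (r2 c b) \<phi>"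
abbreviation "bR3 P c a \<phi> \<equiv> tensor_bind K A C P (r3 c a) \<phi>"
abbreviation "pure1 a b c \<equiv> pure_tensor K AB C (pure_tensor K A B a b) c"
abbreviation "pure2 a b c \<equiv> pure_tensor K A BC a (pure_tensor K B C b c)"
abbreviation "ABC1 \<equiv> tensor K AB C"
abbreviation "ABC2 \<equiv> tensor K A BC"
text \<open>The values at \<open>c \<otimes> (a \<otimes> b) \<otimes> (a' \<otimes> b')\<close> of the two sides of the twisting identity of \<open>T\<^sub>1\<close>
  for the product of \<open>A \<otimes> B\<close>, and similarly for \<open>T\<^sub>2\<close>, with all products expanded.\<close>

abbreviation "lhs1 c a b a' b' \<equiv> bR1 ABC1 b a' (\<lambda>s t. bR3 ABC1 c a (\<lambda>x y. bR3 ABC1 y s (\<lambda>x' y'.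
        bR2 ABC1 y' t (\<lambda>p q. bR2 ABC1 q b' (\<lambda>p' q'.
          pure1 (x \<otimes>\<^bsub>A\<^esub> x') (p \<otimes>\<^bsub>B\<^esub> p') q')))))"
abbreviation "rhs1 c a b a' b' \<equiv> bR3 ABC1 c a (\<lambda>x y. bR2 ABC1 y b (\<lambda>p q. bR3 ABC1 q a' (\<lambda>x' y'.
        bR2 ABC1 y' b' (\<lambda>p' q'. bR1 ABC1 p x' (\<lambda>s t.
          pure1 (x \<otimes>\<^bsub>A\<^esub> s) (t \<otimes>\<^bsub>B\<^esub> p') q')))))"
abbreviation "lhs2 a b c b' c' \<equiv> bR2 ABC2 c b' (\<lambda>s t. bR3 ABC2 c' a (\<lambda>x y. bR3 ABC2 t x (\<lambda>x' y'.
        bR1 ABC2 s x' (\<lambda>p q. bR1 ABC2 b p (\<lambda>p' q'.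
          pure2 p' (q' \<otimes>\<^bsub>B\<^esub> q) (y' \<otimes>\<^bsub>C\<^esub> y))))))"
abbreviation "rhs2 a b c b' c' \<equiv> bR3 ABC2 c' a (\<lambda>x y. bR1 ABC2 b' x (\<lambda>p q. bR3 ABC2 c p (\<lambda>x' y'.
        bR1 ABC2 b x' (\<lambda>p' q'. bR2 ABC2 y' q (\<lambda>s t.
          pure2 p' (q' \<otimes>\<^bsub>B\<^esub> s) (t \<otimes>\<^bsub>C\<^esub> y))))))"

abbreviation "T1 \<equiv> twist_T1 K A B C R2 R3"
abbreviation "T2 \<equiv> twist_T2 K A B C R1 R3"

lemma T1_pure:
  assumes "c \<in> carrier C" "u \<in> carrier AB"
  shows "T1 (pure_tensor K C AB c u) =
    tensor_bind K A B ABC1 u (\<lambda>a b.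
      tensor_bind K A C ABC1 (r3 c a) (\<lambda>x y.
        tensor_bind K B C ABC1 (r2 y b) (\<lambda>p q.
          pure_tensor K AB C (pure_tensor K A B x p) q)))"
  using assms by (simp add: tensor_eval twist_T1_def)

lemma T2_pure:
  assumes "a \<in> carrier A" "v \<in> carrier BC"
  shows "T2 (pure_tensor K BC A v a) =
    tensor_bind K B C ABC2 v (\<lambda>b c.
      tensor_bind K A C ABC2 (r3 c a) (\<lambda>x y.
        tensor_bind K A B ABC2 (r1 b x) (\<lambda>p q.
          pure_tensor K A BC p (pure_tensor K B C q y))))"
  using assms by (simp add: tensor_eval twist_T2_def)

lemma T1_hom [simp]: "T1 \<in> module_hom K (tensor K C AB) ABC1"
  unfolding twist_T1_def
  by (auto intro!: module_hom_o tensor_map_hom tensor_assoc_hom tensor_assoc_inv_hom)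

lemma T2_hom [simp]: "T2 \<in> module_hom K (tensor K BC A) ABC2"
  unfolding twist_T2_def
  by (auto intro!: module_hom_o tensor_map_hom tensor_assoc_hom tensor_assoc_inv_hom)

lemma hexagon_iff:
  "hexagon_equation K A B C R1 R2 R3 \<longleftrightarrow>
    (\<forall>c\<in>carrier C. \<forall>b\<in>carrier B. \<forall>a\<in>carrier A.
      tensor_bind K A B ABC2 (r1 b a) (\<lambda>s t.
        tensor_bind K A C ABC2 (r3 c s) (\<lambda>x y. pure_tensor K A BC x (r2 y t))) =
      tensor_bind K B C ABC2 (r2 c b) (\<lambda>p q.
        tensor_bind K A C ABC2 (r3 q a) (\<lambda>x y.
          tensor_bind K A B ABC2 (r1 p x) (\<lambda>s t.
            pure_tensor K A BC s (pure_tensor K B C t y)))))"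
  unfolding hexagon_equation_def
  by (subst module_hom_eq_on_pure_left[where P = ABC2])
    (auto simp: tensor_eval intro!: module_hom_o tensor_map_hom tensor_assoc_hom tensor_assoc_inv_hom)

lemma twist_data_T1: "twist_data K (twisted_tensor K A B R1) C T1"
  by (rule twist_data.intro) (simp_all add: R1.bilinear_twisted_tensor_mult R2.mult_B T1_hom bilinear_twisted_tensor del: bilinear_iff)

lemma twist_data_T2: "twist_data K A (twisted_tensor K B C R2) T2"
  by (rule twist_data.intro) (simp_all add: R2.bilinear_twisted_tensor_mult R1.mult_A T2_hom bilinear_twisted_tensor del: bilinear_iff)

lemmas T_comp [simp] = module_hom_comp[OF T1_hom] module_hom_comp[OF T2_hom]
lemmas T_closed [simp] = module_homD(1)[OF T1_hom] module_homD(1)[OF T2_hom]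
lemmas twisted_mult_hom [simp] = bilinear_hom[OF R1.bilinear_twisted_tensor_mult] bilinear_hom[OF R2.bilinear_twisted_tensor_mult]
lemmas twisted_mult_closed [simp] = bilinearD(3)[OF R1.bilinear_twisted_tensor_mult] bilinearD(3)[OF R2.bilinear_twisted_tensor_mult]
lemmas T_bind = module_hom_bind[OF T1_hom] module_hom_bind[OF T2_hom]

lemma hexagon_apply:
  assumes "hexagon_equation K A B C R1 R2 R3" "c \<in> carrier C" "b \<in> carrier B" "a \<in> carrier A" "module K P"
    and "\<And>y z. \<lbrakk>y \<in> carrier B; z \<in> carrier C\<rbrakk> \<Longrightarrow> (\<lambda>x. \<psi> x y z) \<in> module_hom K A P"
    and "\<And>x z. \<lbrakk>x \<in> carrier A; z \<in> carrier C\<rbrakk> \<Longrightarrow> (\<lambda>y. \<psi> x y z) \<in> module_hom K B P"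
    and "\<And>x y. \<lbrakk>x \<in> carrier A; y \<in> carrier B\<rbrakk> \<Longrightarrow> \<psi> x y \<in> module_hom K C P"
  shows "bR1 P b a (\<lambda>s t. bR3 P c s (\<lambda>x y. bR2 P y t (\<lambda>p q. \<psi> x p q))) =
    bR2 P c b (\<lambda>p q. bR3 P q a (\<lambda>x y. bR1 P p x (\<lambda>s t. \<psi> s t y)))"
proof -
  let ?\<Psi> = "\<lambda>w. tensor_bind K A BC P w (\<lambda>x v. tensor_bind K B C P v (\<psi> x))"
  have "?\<Psi> (bR1 ABC2 b a (\<lambda>s t. bR3 ABC2 c s (\<lambda>x y. pure_tensor K A BC x (r2 y t)))) =
    ?\<Psi> (bR2 ABC2 c b (\<lambda>p q. bR3 ABC2 q a (\<lambda>x y. bR1 ABC2 p x (\<lambda>s t. pure2 s t y))))"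
    using assms(1-4) unfolding hexagon_iff by simp
  then show ?thesis
    using assms(2-8) by (simp add: tensor_bind_bind)
qed

lemma T1_left_iff:
  "(\<forall>c\<in>carrier C. \<forall>u\<in>carrier AB. \<forall>v\<in>carrier AB.
      T1 (pure_tensor K C AB c (u \<otimes>\<^bsub>twisted_tensor K A B R1\<^esub> v)) =
      tensor_bind K AB C ABC1 (T1 (pure_tensor K C AB c u)) (\<lambda>x y.
        tensor_bind K AB C ABC1 (T1 (pure_tensor K C AB y v)) (\<lambda>x' y'.
          pure_tensor K AB C (x \<otimes>\<^bsub>twisted_tensor K A B R1\<^esub> x') y'))) \<longleftrightarrow>
   (\<forall>c\<in>carrier C. \<forall>a\<in>carrier A. \<forall>b\<in>carrier B. \<forall>a'\<in>carrier A. \<forall>b'\<in>carrier B.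
      lhs1 c a b a' b' = rhs1 c a b a' b')"
  by (intro ball_cong refl, subst bilinear_eq_on_pure[where P = ABC1])
    (simp_all add: R1.twisted_tensor_mult T1_pure T_bind tensor_eval)

lemma T1_right:
  assumes "c \<in> carrier C" "c' \<in> carrier C" "u \<in> carrier AB"
  shows "T1 (pure_tensor K C AB (c \<otimes>\<^bsub>C\<^esub> c') u) =
    tensor_bind K AB C ABC1 (T1 (pure_tensor K C AB c' u)) (\<lambda>x y.
      tensor_bind K AB C ABC1 (T1 (pure_tensor K C AB c x)) (\<lambda>x' y'.
        pure_tensor K AB C x' (y' \<otimes>\<^bsub>C\<^esub> y)))"
proof -
  have "\<forall>u\<in>carrier AB. T1 (pure_tensor K C AB (c \<otimes>\<^bsub>C\<^esub> c') u) =
    tensor_bind K AB C ABC1 (T1 (pure_tensor K C AB c' u)) (\<lambda>x y.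
      tensor_bind K AB C ABC1 (T1 (pure_tensor K C AB c x)) (\<lambda>x' y'.
        pure_tensor K AB C x' (y' \<otimes>\<^bsub>C\<^esub> y)))"
  proof (subst module_hom_eq_on_pure[where P = ABC1], simp_all add: assms, intro ballI)
    fix a b assume a: "a \<in> carrier A" "b \<in> carrier B"
    have swap: "bR3 ABC1 c x (\<lambda>x' y'. bR2 ABC1 y b (\<lambda>p q. bR2 ABC1 y' p (\<lambda>p' q'.
          pure1 x' p' (q' \<otimes>\<^bsub>C\<^esub> q)))) =
        bR2 ABC1 y b (\<lambda>p q. bR3 ABC1 c x (\<lambda>x' y'. bR2 ABC1 y' p (\<lambda>p' q'.
          pure1 x' p' (q' \<otimes>\<^bsub>C\<^esub> q))))" if "x \<in> carrier A" "y \<in> carrier C" for x y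
      using that a assms by (intro tensor_bind_swap) simp_all
    show "T1 (pure_tensor K C AB (c \<otimes>\<^bsub>C\<^esub> c') (pure_tensor K A B a b)) =
      tensor_bind K AB C ABC1 (T1 (pure_tensor K C AB c' (pure_tensor K A B a b))) (\<lambda>x y.
        tensor_bind K AB C ABC1 (T1 (pure_tensor K C AB c x)) (\<lambda>x' y'.
          pure_tensor K AB C x' (y' \<otimes>\<^bsub>C\<^esub> y)))"
      using a assms by (simp add: T1_pure T_bind tensor_eval swap)
  qed
  then show ?thesis using assms by blast
qed

lemma twisting_T1_iff: "twisting_map K (twisted_tensor K A B R1) C T1 \<longleftrightarrow> hexagon_equation K A B C R1 R2 R3"
proof
  assume hex: "hexagon_equation K A B C R1 R2 R3"
  let ?P = ABC1
  have "lhs1 c a b a' b' = rhs1 c a b a' b'"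
    if "c \<in> carrier C" "a \<in> carrier A" "b \<in> carrier B" "a' \<in> carrier A" "b' \<in> carrier B" for c a b a' b'
  proof -
    have "lhs1 c a b a' b' =
        bR3 ?P c a (\<lambda>x y. bR1 ?P b a' (\<lambda>s t. bR3 ?P y s (\<lambda>x' y'.
          bR2 ?P y' t (\<lambda>p q. bR2 ?P q b' (\<lambda>p' q'. pure1 (x \<otimes>\<^bsub>A\<^esub> x') (p \<otimes>\<^bsub>B\<^esub> p') q')))))"
      using that by (intro tensor_bind_swap) simp_all
    also have "\<dots> = bR3 ?P c a (\<lambda>x y. bR2 ?P y b (\<lambda>p q. bR3 ?P q a' (\<lambda>x' y'.
        bR1 ?P p x' (\<lambda>s t. bR2 ?P y' b' (\<lambda>p' q'. pure1 (x \<otimes>\<^bsub>A\<^esub> s) (t \<otimes>\<^bsub>B\<^esub> p') q')))))"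
      using that by (intro tensor_bind_cong refl hexagon_apply[OF hex]) simp_all
    also have "\<dots> = rhs1 c a b a' b'"
      using that by (intro tensor_bind_cong refl tensor_bind_swap) simp_all
    finally show ?thesis .
  qed
  then show "twisting_map K (twisted_tensor K A B R1) C T1"
    unfolding twist_data.twisting_map_iff[OF twist_data_T1] tensor_twisted_tensor
      tensor_bind_twisted_tensor pure_tensor_twisted_tensor twisted_tensor_simps T1_left_iff
    using T1_right by blast
next
  assume "twisting_map K (twisted_tensor K A B R1) C T1"
  then have eq: "\<forall>c\<in>carrier C. \<forall>a\<in>carrier A. \<forall>b\<in>carrier B. \<forall>a'\<in>carrier A. \<forall>b'\<in>carrier B.
      lhs1 c a b a' b' = rhs1 c a b a' b'"
    unfolding twist_data.twisting_map_iff[OF twist_data_T1] tensor_twisted_tensor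
      tensor_bind_twisted_tensor pure_tensor_twisted_tensor twisted_tensor_simps T1_left_iff by blast
  show "hexagon_equation K A B C R1 R2 R3"
    unfolding hexagon_iff
  proof (intro ballI)
    fix c b a assume "c \<in> carrier C" "b \<in> carrier B" "a \<in> carrier A"
    with eq have "lhs1 c \<one>\<^bsub>A\<^esub> b a \<one>\<^bsub>B\<^esub> = rhs1 c \<one>\<^bsub>A\<^esub> b a \<one>\<^bsub>B\<^esub>"
      by (intro eq[rule_format]) simp_all
    from arg_cong[OF this, of "tensor_assoc K A B C"]
    show "bR1 ABC2 b a (\<lambda>s t. bR3 ABC2 c s (\<lambda>x y. pure_tensor K A BC x (r2 y t))) =
      bR2 ABC2 c b (\<lambda>p q. bR3 ABC2 q a (\<lambda>x y.
        bR1 ABC2 p x (\<lambda>s t. pure2 s t y)))"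
      using \<open>c \<in> carrier C\<close> \<open>b \<in> carrier B\<close> \<open>a \<in> carrier A\<close>
      by (simp add: tensor_eval tensor_bind_pure_right_id)
  qed
qed

lemma T2_right_iff:
  "(\<forall>v\<in>carrier BC. \<forall>v'\<in>carrier BC. \<forall>a\<in>carrier A.
      T2 (pure_tensor K BC A (v \<otimes>\<^bsub>twisted_tensor K B C R2\<^esub> v') a) =
      tensor_bind K A BC ABC2 (T2 (pure_tensor K BC A v' a)) (\<lambda>x y.
        tensor_bind K A BC ABC2 (T2 (pure_tensor K BC A v x)) (\<lambda>x' y'.
          pure_tensor K A BC x' (y' \<otimes>\<^bsub>twisted_tensor K B C R2\<^esub> y)))) \<longleftrightarrow>
   (\<forall>a\<in>carrier A. \<forall>b\<in>carrier B. \<forall>c\<in>carrier C. \<forall>b'\<in>carrier B. \<forall>c'\<in>carrier C.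
      lhs2 a b c b' c' = rhs2 a b c b' c')"
  (is "?lhs \<longleftrightarrow> ?rhs")
proof -
  have "?lhs \<longleftrightarrow> (\<forall>a\<in>carrier A. \<forall>v\<in>carrier BC. \<forall>v'\<in>carrier BC.
      T2 (pure_tensor K BC A (v \<otimes>\<^bsub>twisted_tensor K B C R2\<^esub> v') a) =
      tensor_bind K A BC ABC2 (T2 (pure_tensor K BC A v' a)) (\<lambda>x y.
        tensor_bind K A BC ABC2 (T2 (pure_tensor K BC A v x)) (\<lambda>x' y'.
          pure_tensor K A BC x' (y' \<otimes>\<^bsub>twisted_tensor K B C R2\<^esub> y))))"
    by blast
  also have "\<dots> \<longleftrightarrow> ?rhs"
    by (intro ball_cong refl, subst bilinear_eq_on_pure[where P = ABC2])
      (simp_all add: R2.twisted_tensor_mult T2_pure T_bind tensor_eval)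
  finally show ?thesis .
qed

lemma T2_left:
  assumes "v \<in> carrier BC" "a \<in> carrier A" "a' \<in> carrier A"
  shows "T2 (pure_tensor K BC A v (a \<otimes>\<^bsub>A\<^esub> a')) =
    tensor_bind K A BC ABC2 (T2 (pure_tensor K BC A v a)) (\<lambda>x y.
      tensor_bind K A BC ABC2 (T2 (pure_tensor K BC A y a')) (\<lambda>x' y'.
        pure_tensor K A BC (x \<otimes>\<^bsub>A\<^esub> x') y'))"
proof -
  let ?P = ABC2
  have "\<forall>v\<in>carrier BC. T2 (pure_tensor K BC A v (a \<otimes>\<^bsub>A\<^esub> a')) =
    tensor_bind K A BC ?P (T2 (pure_tensor K BC A v a)) (\<lambda>x y.
      tensor_bind K A BC ?P (T2 (pure_tensor K BC A y a')) (\<lambda>x' y'.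
        pure_tensor K A BC (x \<otimes>\<^bsub>A\<^esub> x') y'))"
  proof (subst module_hom_eq_on_pure[where P = ?P], simp_all add: assms, intro ballI)
    fix b c assume b: "b \<in> carrier B" "c \<in> carrier C"
    have swap: "bR3 ?P y a' (\<lambda>x' y'. bR1 ?P b x (\<lambda>p q. bR1 ?P q x' (\<lambda>p' q'.
          pure2 (p \<otimes>\<^bsub>A\<^esub> p') q' y'))) =
        bR1 ?P b x (\<lambda>p q. bR3 ?P y a' (\<lambda>x' y'. bR1 ?P q x' (\<lambda>p' q'.
          pure2 (p \<otimes>\<^bsub>A\<^esub> p') q' y')))" if "x \<in> carrier A" "y \<in> carrier C" for x y
      using that b assms by (intro tensor_bind_swap) simp_all
    show "T2 (pure_tensor K BC A (pure_tensor K B C b c) (a \<otimes>\<^bsub>A\<^esub> a')) =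
      tensor_bind K A BC ?P (T2 (pure_tensor K BC A (pure_tensor K B C b c) a)) (\<lambda>x y.
        tensor_bind K A BC ?P (T2 (pure_tensor K BC A y a')) (\<lambda>x' y'.
          pure_tensor K A BC (x \<otimes>\<^bsub>A\<^esub> x') y'))"
      using b assms by (simp add: T2_pure T_bind tensor_eval swap)
  qed
  then show ?thesis using assms by blast
qed

lemma twisting_T2_iff: "twisting_map K A (twisted_tensor K B C R2) T2 \<longleftrightarrow> hexagon_equation K A B C R1 R2 R3"
proof
  assume hex: "hexagon_equation K A B C R1 R2 R3"
  let ?P = ABC2
  have "lhs2 a b c b' c' = rhs2 a b c b' c'"
    if "a \<in> carrier A" "b \<in> carrier B" "c \<in> carrier C" "b' \<in> carrier B" "c' \<in> carrier C" for a b c b' c'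
  proof -
    have "lhs2 a b c b' c' =
        bR3 ?P c' a (\<lambda>x y. bR2 ?P c b' (\<lambda>s t. bR3 ?P t x (\<lambda>x' y'.
          bR1 ?P s x' (\<lambda>p q. bR1 ?P b p (\<lambda>p' q'. pure2 p' (q' \<otimes>\<^bsub>B\<^esub> q) (y' \<otimes>\<^bsub>C\<^esub> y))))))"
      using that by (intro tensor_bind_swap) simp_all
    also have "\<dots> = bR3 ?P c' a (\<lambda>x y. bR1 ?P b' x (\<lambda>p q. bR3 ?P c p (\<lambda>x' y'.
        bR2 ?P y' q (\<lambda>s t. bR1 ?P b x' (\<lambda>p' q'. pure2 p' (q' \<otimes>\<^bsub>B\<^esub> s) (t \<otimes>\<^bsub>C\<^esub> y))))))"
      using that by (intro tensor_bind_cong refl hexagon_apply[OF hex, symmetric]) simp_all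
    also have "\<dots> = rhs2 a b c b' c'"
      using that by (intro tensor_bind_cong refl tensor_bind_swap) simp_all
    finally show ?thesis .
  qed
  then show "twisting_map K A (twisted_tensor K B C R2) T2"
    unfolding twist_data.twisting_map_iff[OF twist_data_T2] tensor_twisted_tensor
      tensor_bind_twisted_tensor pure_tensor_twisted_tensor twisted_tensor_simps T2_right_iff
    using T2_left by blast
next
  assume "twisting_map K A (twisted_tensor K B C R2) T2"
  then have eq: "\<forall>a\<in>carrier A. \<forall>b\<in>carrier B. \<forall>c\<in>carrier C. \<forall>b'\<in>carrier B. \<forall>c'\<in>carrier C.
      lhs2 a b c b' c' = rhs2 a b c b' c'"
    unfolding twist_data.twisting_map_iff[OF twist_data_T2] tensor_twisted_tensor
      tensor_bind_twisted_tensor pure_tensor_twisted_tensor twisted_tensor_simps T2_right_iff by blast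
  show "hexagon_equation K A B C R1 R2 R3"
    unfolding hexagon_iff
  proof (intro ballI)
    fix c b a assume cba: "c \<in> carrier C" "b \<in> carrier B" "a \<in> carrier A"
    with eq have "lhs2 a \<one>\<^bsub>B\<^esub> c b \<one>\<^bsub>C\<^esub> = rhs2 a \<one>\<^bsub>B\<^esub> c b \<one>\<^bsub>C\<^esub>"
      by (intro eq[rule_format]) simp_all
    then show "bR1 ABC2 b a (\<lambda>s t. bR3 ABC2 c s (\<lambda>x y. pure_tensor K A BC x (r2 y t))) =
      bR2 ABC2 c b (\<lambda>p q. bR3 ABC2 q a (\<lambda>x y.
        bR1 ABC2 p x (\<lambda>s t. pure2 s t y)))"
      using cba by (simp add: tensor_eval tensor_bind_pure_right_id)
  qed
qed

lemma twisted_T1_mult: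
  assumes "x \<in> carrier ABC1" "y \<in> carrier ABC1"
  shows "x \<otimes>\<^bsub>twisted_tensor K (twisted_tensor K A B R1) C T1\<^esub> y =
    tensor_bind K AB C ABC1 x (\<lambda>u c. tensor_bind K AB C ABC1 y (\<lambda>u' c'.
      tensor_bind K AB C ABC1 (T1 (pure_tensor K C AB c u')) (\<lambda>s t.
        pure_tensor K AB C (u \<otimes>\<^bsub>twisted_tensor K A B R1\<^esub> s) (t \<otimes>\<^bsub>C\<^esub> c'))))"
  using twist_data.twisted_tensor_mult[OF twist_data_T1] assms
  unfolding tensor_twisted_tensor tensor_bind_twisted_tensor pure_tensor_twisted_tensor by blast

lemma twisted_T2_mult:
  assumes "x \<in> carrier ABC2" "y \<in> carrier ABC2"
  shows "x \<otimes>\<^bsub>twisted_tensor K A (twisted_tensor K B C R2) T2\<^esub> y =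
    tensor_bind K A BC ABC2 x (\<lambda>a v. tensor_bind K A BC ABC2 y (\<lambda>a' v'.
      tensor_bind K A BC ABC2 (T2 (pure_tensor K BC A v a')) (\<lambda>s t.
        pure_tensor K A BC (a \<otimes>\<^bsub>A\<^esub> s) (t \<otimes>\<^bsub>twisted_tensor K B C R2\<^esub> v'))))"
  using twist_data.twisted_tensor_mult[OF twist_data_T2] assms
  unfolding tensor_twisted_tensor tensor_bind_twisted_tensor pure_tensor_twisted_tensor by blast

lemmas assoc_closed [simp] = module_homD(1)[OF tensor_assoc_hom[OF R1.module_A R1.module_B R2.module_B]]
lemmas assoc_comp [simp] = module_hom_comp[OF tensor_assoc_hom[OF R1.module_A R1.module_B R2.module_B]]

lemma tensor_assoc_mult:
  assumes "x \<in> carrier ABC1" "y \<in> carrier ABC1"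
  shows "tensor_assoc K A B C (x \<otimes>\<^bsub>twisted_tensor K (twisted_tensor K A B R1) C T1\<^esub> y) =
    tensor_assoc K A B C x \<otimes>\<^bsub>twisted_tensor K A (twisted_tensor K B C R2) T2\<^esub> tensor_assoc K A B C y"
proof -
  let ?P = ABC2
  let ?F = "\<lambda>x y. tensor_assoc K A B C (tensor_bind K AB C ABC1 x (\<lambda>u c. tensor_bind K AB C ABC1 y (\<lambda>u' c'.
      tensor_bind K AB C ABC1 (T1 (pure_tensor K C AB c u')) (\<lambda>s t.
        pure_tensor K AB C (u \<otimes>\<^bsub>twisted_tensor K A B R1\<^esub> s) (t \<otimes>\<^bsub>C\<^esub> c')))))"
  let ?G = "\<lambda>x y. tensor_bind K A BC ?P (tensor_assoc K A B C x) (\<lambda>a v. tensor_bind K A BC ?P (tensor_assoc K A B C y) (\<lambda>a' v'.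
      tensor_bind K A BC ?P (T2 (pure_tensor K BC A v a')) (\<lambda>s t.
        pure_tensor K A BC (a \<otimes>\<^bsub>A\<^esub> s) (t \<otimes>\<^bsub>twisted_tensor K B C R2\<^esub> v'))))"
  have pure: "?F (pure1 a b c) (pure1 a' b' c') = ?G (pure1 a b c) (pure1 a' b' c')"
    if "a \<in> carrier A" "b \<in> carrier B" "c \<in> carrier C" "a' \<in> carrier A" "b' \<in> carrier B" "c' \<in> carrier C"
    for a b c a' b' c'
  proof -
    have swap: "bR2 ?P y b' (\<lambda>p q. bR1 ?P b x (\<lambda>s t. pure2 (a \<otimes>\<^bsub>A\<^esub> s) (t \<otimes>\<^bsub>B\<^esub> p) (q \<otimes>\<^bsub>C\<^esub> c'))) =
        bR1 ?P b x (\<lambda>s t. bR2 ?P y b' (\<lambda>p q. pure2 (a \<otimes>\<^bsub>A\<^esub> s) (t \<otimes>\<^bsub>B\<^esub> p) (q \<otimes>\<^bsub>C\<^esub> c')))"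
      if "x \<in> carrier A" "y \<in> carrier C" for x y
      using that \<open>a \<in> carrier A\<close> \<open>b \<in> carrier B\<close> \<open>b' \<in> carrier B\<close> \<open>c' \<in> carrier C\<close>
      by (intro tensor_bind_swap) simp_all
    show ?thesis
      using that by (simp add: T1_pure T2_pure T_bind tensor_eval R1.twisted_tensor_mult R2.twisted_tensor_mult swap)
  qed
  have "\<forall>u\<in>carrier AB. \<forall>u'\<in>carrier AB. ?F (pure_tensor K AB C u c) (pure_tensor K AB C u' c') =
      ?G (pure_tensor K AB C u c) (pure_tensor K AB C u' c')"
    if "c \<in> carrier C" "c' \<in> carrier C" for c c'
    using that by (intro bilinear_eq_on_pure[where P = ?P, THEN iffD2] ballI pure) simp_all
  then have "\<forall>x\<in>carrier ABC1. \<forall>y\<in>carrier ABC1. ?F x y = ?G x y"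
    by (intro bilinear_eq_on_pure[where P = ?P, THEN iffD2]) simp_all
  then show ?thesis
    using assms by (simp add: twisted_T1_mult twisted_T2_mult)
qed

lemma tensor_assoc_iso:
  "tensor_assoc K A B C \<in> algebra_iso K (twisted_tensor K (twisted_tensor K A B R1) C T1)
     (twisted_tensor K A (twisted_tensor K B C R2) T2)"
  unfolding algebra_iso_def ring_iso_def
proof (intro IntI CollectI conjI ring_hom_memI)
  show "tensor_assoc K A B C \<one>\<^bsub>twisted_tensor K (twisted_tensor K A B R1) C T1\<^esub> =
      \<one>\<^bsub>twisted_tensor K A (twisted_tensor K B C R2) T2\<^esub>"
    by (simp add: tensor_eval)
qed (simp_all add: tensor_assoc_mult tensor_assoc_bij module_homD(2)[OF tensor_assoc_hom])

end

lemma assoc_algebra_bilinear: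
  assumes "assoc_algebra K A"
  shows "bilinear K A A A (mult A)"
proof -
  interpret assoc_algebra K A by fact
  show ?thesis
    by (auto simp: bilinear_def A.l_distr A.r_distr smult_mult_left smult_mult_right intro!: module_homI)
qed

lemma unital_twisting_map_data:
  assumes "assoc_algebra K A" "assoc_algebra K B" "unital_twisting_map K A B R"
  shows "twist_data K A B R"
  using assms assoc_algebra_bilinear[OF assms(1)] assoc_algebra_bilinear[OF assms(2)]
  by (intro twist_data.intro)
    (auto simp: assoc_algebra_def unital_twisting_map_def twisting_map_def simp del: bilinear_iff)

theorem theorem2p1:
  fixes K :: "('k, 'r) ring_scheme"
    and A :: "('k, 'a) module" and B :: "('k, 'b) module" and C :: "('k, 'c) module"
    and R1 :: "('k, 'b, 'a) tensor \<Rightarrow> ('k, 'a, 'b) tensor"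
    and R2 :: "('k, 'c, 'b) tensor \<Rightarrow> ('k, 'b, 'c) tensor"
    and R3 :: "('k, 'c, 'a) tensor \<Rightarrow> ('k, 'a, 'c) tensor"
  defines "AB \<equiv> twisted_tensor K A B R1"
    and "BC \<equiv> twisted_tensor K B C R2"
    and "T1 \<equiv> twist_T1 K A B C R2 R3"
    and "T2 \<equiv> twist_T2 K A B C R1 R3"
  assumes "cring K"
    and "assoc_algebra K A" and "assoc_algebra K B" and "assoc_algebra K C"
    and "unital_twisting_map K A B R1"
    and "unital_twisting_map K B C R2"
    and "unital_twisting_map K A C R3"
  shows "(twisting_map K AB C T1 \<longleftrightarrow> twisting_map K A BC T2) \<and>
    (twisting_map K A BC T2 \<longleftrightarrow> hexagon_equation K A B C R1 R2 R3) \<and>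
    (hexagon_equation K A B C R1 R2 R3 \<longrightarrow>
      tensor_assoc K A B C \<in> algebra_iso K (twisted_tensor K AB C T1) (twisted_tensor K A BC T2))"
proof -
  note data = unital_twisting_map_data[OF assms(6,7,9)] unital_twisting_map_data[OF assms(7,8,10)]
    unital_twisting_map_data[OF assms(6,8,11)]
  interpret A: assoc_algebra K A by fact
  interpret B: assoc_algebra K B by fact
  interpret C: assoc_algebra K C by fact
  note tw = assms(9-11)[unfolded unital_twisting_map_def twist_data.twisting_map_iff[OF data(1)]
      twist_data.twisting_map_iff[OF data(2)] twist_data.twisting_map_iff[OF data(3)]]
  interpret T: twist_triple K A B C R1 R2 R3
    by (intro twist_triple.intro twist_triple_axioms.intro data) (use tw in \<open>blast | simp\<close>)+
  show ?thesis
    unfolding AB_def BC_def T1_def T2_def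
    using T.twisting_T1_iff T.twisting_T2_iff T.tensor_assoc_iso by blast
qed

end
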